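(* Let $H:\mathrm{Set}\to \mathrm{Set}$ be an $\omega^{op}$-continuous endofunctor and let $\mathbf{M}=(M,m,u)$ be a monad on $\mathrm{Set}$ such that: 1. $H$ admits a lifting $\widetilde{H}$ to $\mathrm{Alg}(\mathbf{M})$ which is $\omega$-cocontinuous; 2. $M0=1$ in $\mathrm{Alg}(\mathbf{M})$, i.e. the unique algebra morphism $s:F^{\mathbf{M}}0\to 1$ from the initial to the terminal $\mathbf{M}$-algebra is an isomorphism. Then the final $H$-coalgebra is the completion of the initial $\widetilde{H}$-algebra under the (ultra)metric coming from the final sequence. That is, let $L$ be the final $H$-coalgebra with its ultrametric $d$, let $I$ be the initial $\widetilde{H}$-algebra, and let $f:I\to L$ be the canonical $\mathbf{M}$-algebra morphism (all as specified in the context). Then $(L,d)$ is a complete metric space and the image $f(I)$ is dense in $L$, so that $(L,d)$ is the Cauchy completion of $f(I)$ with the metric inherited from $d$ (equivalently, of $I$ with the (pseudo-)ultrametric $(a,b)\mapsto d(f(a),f(b))$).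
   Context: $\mathrm{Alg}(\mathbf{M})$ is the Eilenberg-Moore category of $\mathbf{M}$-algebras, with forgetful functor $U^{\mathbf{M}}:\mathrm{Alg}(\mathbf{M})\to \mathrm{Set}$ and free functor $F^{\mathbf{M}}\dashv U^{\mathbf{M}}$. Its initial object is $F^{\mathbf{M}}0=(M0,m_0)$, the free algebra on the empty set $0$; its terminal object is the singleton $1$ with its unique algebra structure. A lifting of $H$ to $\mathrm{Alg}(\mathbf{M})$ is an endofunctor $\widetilde{H}$ of $\mathrm{Alg}(\mathbf{M})$ with $U^{\mathbf{M}}\widetilde{H}=HU^{\mathbf{M}}$. $\omega^{op}$-continuous means preserving limits of $\omega^{op}$-chains; $\omega$-cocontinuous means preserving colimits of $\omega$-chains. Final sequence: let $t:H1\to 1$ be the unique map and consider the $\omega^{op}$-chain $1\xleftarrow{t}H1\xleftarrow{Ht}H^21\leftarrow\cdots$, with connecting maps $H^nt:H^{n+1}1\to H^n1$. Let $L$ be its limit in $\mathrm{Set}$, with projections $p_n:L\to H^n1$. Since $H$ is $\omega^{op}$-continuous, there is a unique isomorphism $\xi:L\to HL$ with $Hp_{n-1}\circ\xi=p_n$ for all $n\ge 1$, and $(L,\xi)$ is the final $H$-coalgebra. The ultrametric $d$ on $L$ is given by $d(x,x)=0$ and, for $x\neq y$, $d(x,y)=2^{-n}$ where $n$ is the smallest natural number with $p_n(x)\ne p_n(y)$. The final sequence is also a chain in $\mathrm{Alg}(\mathbf{M})$ (namely the chain $\widetilde{H}^n1$), and $L$, with the corresponding limit algebra structure, is its limit in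 $\mathrm{Alg}(\mathbf{M})$. Initial sequence: let $!:F^{\mathbf{M}}0\to\widetilde{H}F^{\mathbf{M}}0$ be the unique algebra morphism. The initial $\widetilde{H}$-algebra $I$ is the colimit in $\mathrm{Alg}(\mathbf{M})$ of the $\omega$-chain $F^{\mathbf{M}}0\xrightarrow{!}\widetilde{H}F^{\mathbf{M}}0\xrightarrow{\widetilde{H}!}\widetilde{H}^2F^{\mathbf{M}}0\to\cdots$, with colimit cocone $i_n:\widetilde{H}^nF^{\mathbf{M}}0\to I$ (the underlying set of $\widetilde{H}^nF^{\mathbf{M}}0$ is $H^nM0$). Canonical morphism: $f:I\to L$ is the unique $\mathbf{M}$-algebra morphism such that $p_n\circ f\circ i_n=H^ns$ for all $n\ge 0$, where $s:F^{\mathbf{M}}0\to 1$ is the unique algebra morphism. *)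

theory Defs
  imports "HOL-Analysis.Analysis" "HOL-Library.Equipollence" "HOL-Library.FuncSet"
begin

section \<open>Categories and functors\<close>

record ('o, 'm) category =
  Obj :: "'o set"
  Hom :: "'o \<Rightarrow> 'o \<Rightarrow> 'm set"
  Id :: "'o \<Rightarrow> 'm"
  Comp :: "'m \<Rightarrow> 'm \<Rightarrow> 'm" (infixr "\<cdot>\<index>" 70)

record ('o, 'm, 'p, 'n) functor_data =
  ob :: "'o \<Rightarrow> 'p"
  ar :: "'m \<Rightarrow> 'n"

definition is_functor ::
  "('o, 'm) category \<Rightarrow> ('p, 'n) category \<Rightarrow> ('o, 'm, 'p, 'n, 'z) functor_data_scheme \<Rightarrow> bool" where
  "is_functor C D F \<longleftrightarrow>
     (\<forall>a \<in> Obj C. ob F a \<in> Obj D) \<and>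
     (\<forall>a \<in> Obj C. \<forall>b \<in> Obj C. \<forall>f \<in> Hom C a b. ar F f \<in> Hom D (ob F a) (ob F b)) \<and>
     (\<forall>a \<in> Obj C. ar F (Id C a) = Id D (ob F a)) \<and>
     (\<forall>a \<in> Obj C. \<forall>b \<in> Obj C. \<forall>c \<in> Obj C. \<forall>f \<in> Hom C a b. \<forall>g \<in> Hom C b c.
        ar F (g \<cdot>\<^bsub>C\<^esub> f) = ar F g \<cdot>\<^bsub>D\<^esub> ar F f)"

definition is_iso :: "('o, 'm) category \<Rightarrow> 'o \<Rightarrow> 'o \<Rightarrow> 'm \<Rightarrow> bool" where
  "is_iso C a b f \<longleftrightarrow>
     f \<in> Hom C a b \<and> (\<exists>g \<in> Hom C b a. g \<cdot>\<^bsub>C\<^esub> f = Id C a \<and> f \<cdot>\<^bsub>C\<^esub> g = Id C b)"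

text \<open>The unique arrow between two objects; used only where exactly one arrow exists.\<close>

definition the_arrow :: "('o, 'm) category \<Rightarrow> 'o \<Rightarrow> 'o \<Rightarrow> 'm" where
  "the_arrow C a b = (THE f. f \<in> Hom C a b)"


section \<open>Limits of \<open>\<omega>\<^sup>o\<^sup>p\<close>-chains and colimits of \<open>\<omega>\<close>-chains\<close>

definition op_chain :: "('o, 'm) category \<Rightarrow> (nat \<Rightarrow> 'o) \<Rightarrow> (nat \<Rightarrow> 'm) \<Rightarrow> bool" where
  "op_chain C X x \<longleftrightarrow> (\<forall>n. X n \<in> Obj C \<and> x n \<in> Hom C (X (Suc n)) (X n))"

definition is_cone ::
  "('o, 'm) category \<Rightarrow> (nat \<Rightarrow> 'o) \<Rightarrow> (nat \<Rightarrow> 'm) \<Rightarrow> 'o \<Rightarrow> (nat \<Rightarrow> 'm) \<Rightarrow> bool" where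
  "is_cone C X x L p \<longleftrightarrow>
     L \<in> Obj C \<and> (\<forall>n. p n \<in> Hom C L (X n) \<and> x n \<cdot>\<^bsub>C\<^esub> p (Suc n) = p n)"

definition is_limit ::
  "('o, 'm) category \<Rightarrow> (nat \<Rightarrow> 'o) \<Rightarrow> (nat \<Rightarrow> 'm) \<Rightarrow> 'o \<Rightarrow> (nat \<Rightarrow> 'm) \<Rightarrow> bool" where
  "is_limit C X x L p \<longleftrightarrow>
     is_cone C X x L p \<and>
     (\<forall>Q q. is_cone C X x Q q \<longrightarrow> (\<exists>!h. h \<in> Hom C Q L \<and> (\<forall>n. p n \<cdot>\<^bsub>C\<^esub> h = q n)))"

definition chain :: "('o, 'm) category \<Rightarrow> (nat \<Rightarrow> 'o) \<Rightarrow> (nat \<Rightarrow> 'm) \<Rightarrow> bool" where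
  "chain C X x \<longleftrightarrow> (\<forall>n. X n \<in> Obj C \<and> x n \<in> Hom C (X n) (X (Suc n)))"

definition is_cocone ::
  "('o, 'm) category \<Rightarrow> (nat \<Rightarrow> 'o) \<Rightarrow> (nat \<Rightarrow> 'm) \<Rightarrow> 'o \<Rightarrow> (nat \<Rightarrow> 'm) \<Rightarrow> bool" where
  "is_cocone C X x I i \<longleftrightarrow>
     I \<in> Obj C \<and> (\<forall>n. i n \<in> Hom C (X n) I \<and> i (Suc n) \<cdot>\<^bsub>C\<^esub> x n = i n)"

definition is_colimit ::
  "('o, 'm) category \<Rightarrow> (nat \<Rightarrow> 'o) \<Rightarrow> (nat \<Rightarrow> 'm) \<Rightarrow> 'o \<Rightarrow> (nat \<Rightarrow> 'm) \<Rightarrow> bool" where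
  "is_colimit C X x I i \<longleftrightarrow>
     is_cocone C X x I i \<and>
     (\<forall>Q q. is_cocone C X x Q q \<longrightarrow> (\<exists>!h. h \<in> Hom C I Q \<and> (\<forall>n. h \<cdot>\<^bsub>C\<^esub> i n = q n)))"

definition omega_op_continuous ::
  "('o, 'm) category \<Rightarrow> ('p, 'n) category \<Rightarrow> ('o, 'm, 'p, 'n, 'z) functor_data_scheme \<Rightarrow> bool" where
  "omega_op_continuous C D F \<longleftrightarrow>
     (\<forall>X x L p. op_chain C X x \<and> is_limit C X x L p \<longrightarrow>
        is_limit D (\<lambda>n. ob F (X n)) (\<lambda>n. ar F (x n)) (ob F L) (\<lambda>n. ar F (p n)))"

definition omega_cocontinuous ::
  "('o, 'm) category \<Rightarrow> ('p, 'n) category \<Rightarrow> ('o, 'm, 'p, 'n, 'z) functor_data_scheme \<Rightarrow> bool" where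
  "omega_cocontinuous C D F \<longleftrightarrow>
     (\<forall>X x I i. chain C X x \<and> is_colimit C X x I i \<longrightarrow>
        is_colimit D (\<lambda>n. ob F (X n)) (\<lambda>n. ar F (x n)) (ob F I) (\<lambda>n. ar F (i n)))"


section \<open>Algebras and coalgebras of an endofunctor\<close>

definition final_coalgebra ::
  "('o, 'm) category \<Rightarrow> ('o, 'm, 'o, 'm, 'z) functor_data_scheme \<Rightarrow> 'o \<Rightarrow> 'm \<Rightarrow> bool" where
  "final_coalgebra C F A a \<longleftrightarrow>
     A \<in> Obj C \<and> a \<in> Hom C A (ob F A) \<and>
     (\<forall>B b. B \<in> Obj C \<and> b \<in> Hom C B (ob F B) \<longrightarrow>
        (\<exists>!h. h \<in> Hom C B A \<and> a \<cdot>\<^bsub>C\<^esub> h = ar F h \<cdot>\<^bsub>C\<^esub> b))"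

definition initial_algebra ::
  "('o, 'm) category \<Rightarrow> ('o, 'm, 'o, 'm, 'z) functor_data_scheme \<Rightarrow> 'o \<Rightarrow> 'm \<Rightarrow> bool" where
  "initial_algebra C F A a \<longleftrightarrow>
     A \<in> Obj C \<and> a \<in> Hom C (ob F A) A \<and>
     (\<forall>B b. B \<in> Obj C \<and> b \<in> Hom C (ob F B) B \<longrightarrow>
        (\<exists>!h. h \<in> Hom C A B \<and> h \<cdot>\<^bsub>C\<^esub> a = b \<cdot>\<^bsub>C\<^esub> ar F h))"


section \<open>Monads, Eilenberg-Moore algebras, liftings\<close>

record ('o, 'm) monad_data = "('o, 'm, 'o, 'm) functor_data" +
  mult :: "'o \<Rightarrow> 'm"
  unit :: "'o \<Rightarrow> 'm"

definition is_monad :: "('o, 'm) category \<Rightarrow> ('o, 'm) monad_data \<Rightarrow> bool" where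
  "is_monad C M \<longleftrightarrow>
     is_functor C C M \<and>
     (\<forall>a \<in> Obj C. mult M a \<in> Hom C (ob M (ob M a)) (ob M a)) \<and>
     (\<forall>a \<in> Obj C. unit M a \<in> Hom C a (ob M a)) \<and>
     (\<forall>a \<in> Obj C. \<forall>b \<in> Obj C. \<forall>f \<in> Hom C a b.
        mult M b \<cdot>\<^bsub>C\<^esub> ar M (ar M f) = ar M f \<cdot>\<^bsub>C\<^esub> mult M a) \<and>
     (\<forall>a \<in> Obj C. \<forall>b \<in> Obj C. \<forall>f \<in> Hom C a b.
        unit M b \<cdot>\<^bsub>C\<^esub> f = ar M f \<cdot>\<^bsub>C\<^esub> unit M a) \<and>
     (\<forall>a \<in> Obj C. mult M a \<cdot>\<^bsub>C\<^esub> ar M (mult M a) = mult M a \<cdot>\<^bsub>C\<^esub> mult M (ob M a)) \<and>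
     (\<forall>a \<in> Obj C. mult M a \<cdot>\<^bsub>C\<^esub> unit M (ob M a) = Id C (ob M a)) \<and>
     (\<forall>a \<in> Obj C. mult M a \<cdot>\<^bsub>C\<^esub> ar M (unit M a) = Id C (ob M a))"

text \<open>
  An arrow is its underlying map together with its source and target, so that arrows with
  the same underlying map but different source or target are distinct.
\<close>

datatype ('o, 'x) arrow = Arrow (src: 'o) (und: 'x) (trg: 'o)

definition Alg ::
  "('o, 'm) category \<Rightarrow> ('o, 'm) monad_data \<Rightarrow> ('o \<times> 'm, ('o \<times> 'm, 'm) arrow) category" where
  "Alg C M =
    (let algebras = {(A, a). A \<in> Obj C \<and> a \<in> Hom C (ob M A) A \<and>
                       a \<cdot>\<^bsub>C\<^esub> unit M A = Id C A \<and>
                       a \<cdot>\<^bsub>C\<^esub> mult M A = a \<cdot>\<^bsub>C\<^esub> ar M a}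
     in \<lparr> Obj = algebras,
          Hom = (\<lambda>X Y. {h. X \<in> algebras \<and> Y \<in> algebras \<and> src h = X \<and> trg h = Y \<and>
                           und h \<in> Hom C (fst X) (fst Y) \<and>
                           und h \<cdot>\<^bsub>C\<^esub> snd X = snd Y \<cdot>\<^bsub>C\<^esub> ar M (und h)}),
          Id = (\<lambda>X. Arrow X (Id C (fst X)) X),
          Comp = (\<lambda>g f. Arrow (src f) (und g \<cdot>\<^bsub>C\<^esub> und f) (trg g)) \<rparr>)"

text \<open>
  The forgetful functor sends \<open>X\<close> to \<open>fst X\<close> and \<open>h\<close> to \<open>und h\<close>, so the last two conditions
  say that it intertwines the lifting with \<open>H\<close>.
\<close>

definition is_lifting ::
  "('o, 'm) category \<Rightarrow> ('o, 'm) monad_data \<Rightarrow> ('o, 'm, 'o, 'm) functor_data \<Rightarrow>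
   ('o \<times> 'm, ('o \<times> 'm, 'm) arrow, 'o \<times> 'm, ('o \<times> 'm, 'm) arrow) functor_data \<Rightarrow> bool" where
  "is_lifting C M H Ht \<longleftrightarrow>
     is_functor (Alg C M) (Alg C M) Ht \<and>
     (\<forall>X \<in> Obj (Alg C M). fst (ob Ht X) = ob H (fst X)) \<and>
     (\<forall>X \<in> Obj (Alg C M). \<forall>Y \<in> Obj (Alg C M). \<forall>h \<in> Hom (Alg C M) X Y.
        und (ar Ht h) = ar H (und h))"

definition free_alg :: "('o, 'm) monad_data \<Rightarrow> 'o \<Rightarrow> 'o \<times> 'm" where
  "free_alg M A = (ob M A, mult M A)"


section \<open>The category of sets\<close>

text \<open>
  HOL has no type of all sets. The category of sets is the category of the members of a
  universe \<open>V\<close>, which is a family of sets over an arbitrary type closed under the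
  constructions below (up to bijection). Every Grothendieck universe with an infinite
  member yields such a family: take its elements as the type and its members as \<open>V\<close>.
\<close>

definition set_universe :: "'u set set \<Rightarrow> bool" where
  "set_universe V \<longleftrightarrow>
     (\<exists>A \<in> V. infinite A) \<and>
     (\<forall>A \<in> V. \<forall>B. B \<lesssim> A \<longrightarrow> B \<in> V) \<and>
     (\<forall>A :: nat \<Rightarrow> 'u set. (\<forall>n. A n \<in> V) \<longrightarrow> (\<exists>B \<in> V. B \<approx> (\<Pi>\<^sub>E n \<in> UNIV. A n)))"

type_synonym 'u set_arrow = "('u set, 'u \<Rightarrow> 'u) arrow"

text \<open>Underlying functions are extensional, so that arrows are equal iff they agree on the source.\<close>

definition Sets :: "'u set set \<Rightarrow> ('u set, 'u set_arrow) category" where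
  "Sets V =
     \<lparr> Obj = V,
       Hom = (\<lambda>A B. {f. A \<in> V \<and> B \<in> V \<and> src f = A \<and> trg f = B \<and> und f \<in> A \<rightarrow>\<^sub>E B}),
       Id = (\<lambda>A. Arrow A (restrict id A) A),
       Comp = (\<lambda>g f. Arrow (src f) (compose (src f) (und g) (und f)) (trg g)) \<rparr>"

type_synonym 'u set_endofunctor = "('u set, 'u set_arrow, 'u set, 'u set_arrow) functor_data"
type_synonym 'u set_monad = "('u set, 'u set_arrow) monad_data"
type_synonym 'u alg = "'u set \<times> 'u set_arrow"
type_synonym 'u alg_arrow = "('u alg, 'u set_arrow) arrow"
type_synonym 'u alg_endofunctor = "('u alg, 'u alg_arrow, 'u alg, 'u alg_arrow) functor_data"


section \<open>The final and the initial sequence\<close>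

text \<open>In the following the singleton \<open>1\<close> is \<open>{e}\<close> for an arbitrary element \<open>e\<close>.\<close>

definition one_alg :: "'u set set \<Rightarrow> 'u set_monad \<Rightarrow> 'u \<Rightarrow> 'u alg" where
  "one_alg V M e = ({e}, the_arrow (Sets V) (ob M {e}) {e})"

definition init_to_one :: "'u set set \<Rightarrow> 'u set_monad \<Rightarrow> 'u \<Rightarrow> 'u alg_arrow" where
  "init_to_one V M e = the_arrow (Alg (Sets V) M) (free_alg M {}) (one_alg V M e)"

definition final_seq_ob :: "'u set_endofunctor \<Rightarrow> 'u \<Rightarrow> nat \<Rightarrow> 'u set" where
  "final_seq_ob H e n = (ob H ^^ n) {e}"

definition final_seq_ar :: "'u set set \<Rightarrow> 'u set_endofunctor \<Rightarrow> 'u \<Rightarrow> nat \<Rightarrow> 'u set_arrow" where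
  "final_seq_ar V H e n = (ar H ^^ n) (the_arrow (Sets V) (ob H {e}) {e})"

definition alg_final_seq_ob ::
  "'u set set \<Rightarrow> 'u set_monad \<Rightarrow> 'u alg_endofunctor \<Rightarrow> 'u \<Rightarrow> nat \<Rightarrow> 'u alg" where
  "alg_final_seq_ob V M Ht e n = (ob Ht ^^ n) (one_alg V M e)"

definition alg_final_seq_ar ::
  "'u set set \<Rightarrow> 'u set_monad \<Rightarrow> 'u alg_endofunctor \<Rightarrow> 'u \<Rightarrow> nat \<Rightarrow> 'u alg_arrow" where
  "alg_final_seq_ar V M Ht e n =
     (ar Ht ^^ n) (the_arrow (Alg (Sets V) M) (ob Ht (one_alg V M e)) (one_alg V M e))"

definition init_seq_ob :: "'u set_monad \<Rightarrow> 'u alg_endofunctor \<Rightarrow> nat \<Rightarrow> 'u alg" where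
  "init_seq_ob M Ht n = (ob Ht ^^ n) (free_alg M {})"

definition init_seq_ar ::
  "'u set set \<Rightarrow> 'u set_monad \<Rightarrow> 'u alg_endofunctor \<Rightarrow> nat \<Rightarrow> 'u alg_arrow" where
  "init_seq_ar V M Ht n =
     (ar Ht ^^ n) (the_arrow (Alg (Sets V) M) (free_alg M {}) (ob Ht (free_alg M {})))"

text \<open>
  The limit \<open>L\<close> (with projections \<open>p\<close>) of the final sequence in sets, equipped with the
  algebra structure that makes it the limit of the final sequence in algebras.
\<close>

definition limit_alg ::
  "'u set set \<Rightarrow> 'u set_monad \<Rightarrow> 'u alg_endofunctor \<Rightarrow> 'u \<Rightarrow>
   'u set \<Rightarrow> (nat \<Rightarrow> 'u set_arrow) \<Rightarrow> 'u alg" where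
  "limit_alg V M Ht e L p =
     (L, THE l. is_limit (Alg (Sets V) M) (alg_final_seq_ob V M Ht e) (alg_final_seq_ar V M Ht e)
                  (L, l) (\<lambda>n. Arrow (L, l) (p n) (alg_final_seq_ob V M Ht e n)))"

definition canonical_morphism ::
  "'u set set \<Rightarrow> 'u set_endofunctor \<Rightarrow> 'u set_monad \<Rightarrow> 'u alg_endofunctor \<Rightarrow> 'u \<Rightarrow>
   'u set \<Rightarrow> (nat \<Rightarrow> 'u set_arrow) \<Rightarrow> 'u alg \<Rightarrow> (nat \<Rightarrow> 'u alg_arrow) \<Rightarrow> 'u alg_arrow \<Rightarrow> bool" where
  "canonical_morphism V H M Ht e L p I i f \<longleftrightarrow>
     f \<in> Hom (Alg (Sets V) M) I (limit_alg V M Ht e L p) \<and>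
     (\<forall>n. p n \<cdot>\<^bsub>Sets V\<^esub> und f \<cdot>\<^bsub>Sets V\<^esub> und (i n) = (ar H ^^ n) (und (init_to_one V M e)))"


section \<open>Ultrametrics and completions\<close>

text \<open>\<open>p n\<close> is the \<open>n\<close>-th projection as an arrow of sets, \<open>und (p n)\<close> the function itself.\<close>

definition seq_dist :: "(nat \<Rightarrow> 'u set_arrow) \<Rightarrow> 'u \<Rightarrow> 'u \<Rightarrow> real" where
  "seq_dist p x y = (if x = y then 0 else 1 / 2 ^ (LEAST n. und (p n) x \<noteq> und (p n) y))"

definition pseudo_ultrametric :: "'a set \<Rightarrow> ('a \<Rightarrow> 'a \<Rightarrow> real) \<Rightarrow> bool" where
  "pseudo_ultrametric X d \<longleftrightarrow>
     (\<forall>x \<in> X. \<forall>y \<in> X. 0 \<le> d x y) \<and>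
     (\<forall>x \<in> X. d x x = 0) \<and>
     (\<forall>x \<in> X. \<forall>y \<in> X. d x y = d y x) \<and>
     (\<forall>x \<in> X. \<forall>y \<in> X. \<forall>z \<in> X. d x z \<le> max (d x y) (d y z))"

text \<open>
  \<open>(Y, d')\<close> together with \<open>j : X \<rightarrow> Y\<close> is the Cauchy completion of \<open>(X, d)\<close>. If \<open>d\<close> is only
  a pseudometric, \<open>j\<close> identifies points at distance zero.
\<close>

definition is_cauchy_completion ::
  "'a set \<Rightarrow> ('a \<Rightarrow> 'a \<Rightarrow> real) \<Rightarrow> 'b set \<Rightarrow> ('b \<Rightarrow> 'b \<Rightarrow> real) \<Rightarrow> ('a \<Rightarrow> 'b) \<Rightarrow> bool" where
  "is_cauchy_completion X d Y d' j \<longleftrightarrow>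
     Metric_space Y d' \<and> Metric_space.mcomplete Y d' \<and>
     j ` X \<subseteq> Y \<and>
     (\<forall>a \<in> X. \<forall>b \<in> X. d' (j a) (j b) = d a b) \<and>
     Metric_space.mtopology Y d' closure_of (j ` X) = Y"

end

theory Submission
  imports Defs
begin

text \<open>
  The completeness of \<open>L\<close> is the universal property of the limit read off at points. Two points
  have distance less than \<open>1 / 2 ^ n\<close> exactly when \<open>p n\<close> identifies them
  (\<open>seq_dist_less_iff\<close>). Hence along a Cauchy sequence each projection is eventually constant,
  the eventual values are compatible with the connecting maps, and as maps from a singleton they
  form a cone, whose factorization through \<open>L\<close> is the limit point (\<open>mcomplete_if_threads\<close>,
  \<open>Sets_limit_thread\<close>).

  Density is where \<open>M0 = 1\<close> enters. The canonical morphism \<open>f\<close> satisfies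
  \<open>p n \<circ> f \<circ> i n = H^n s\<close>, and \<open>s\<close> is invertible, so \<open>H^n s\<close> is invertible too, because functors
  preserve isomorphisms. Thus every element of \<open>H^n 1\<close> is the \<open>n\<close>-th projection of a point
  of \<open>f(I)\<close>, which says that each point of \<open>L\<close> can be approximated to any precision.

  The canonical morphism itself comes from initiality. The limit \<open>L\<close> carries a unique algebra
  structure making it the limit of the final sequence of algebras
  (\<open>forgetful_creates_limits\<close>). The projections of this algebra, moved up by one step, induce a
  morphism \<open>z\<close> from the lifted functor applied to \<open>L\<close> back to \<open>L\<close>; the arrow that the
  initial algebra \<open>I\<close> has into \<open>(L, z)\<close> is \<open>f\<close>, and its equations follow by
  induction (\<open>canonical_arrow_unique_exists\<close>). It is unique since an arrow from a colimit of a
  chain to a limit of a chain is determined by its diagonal components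
  (\<open>chain_limit_arrow_eqI\<close>).

  That \<open>L\<close> is the final coalgebra and \<open>I\<close> the initial algebra are dual instances of
  one classical construction (\<open>final_coalgebra_of_limit\<close>).
\<close>

section \<open>Categories and duality\<close>

locale category_laws =
  fixes C :: "('o, 'm) category" (structure)
  assumes hom_objs: "f \<in> Hom C a b \<Longrightarrow> a \<in> Obj C \<and> b \<in> Obj C"
    and id_hom: "a \<in> Obj C \<Longrightarrow> Id C a \<in> Hom C a a"
    and comp_hom: "f \<in> Hom C a b \<Longrightarrow> g \<in> Hom C b c \<Longrightarrow> g \<cdot> f \<in> Hom C a c"
    and id_left: "f \<in> Hom C a b \<Longrightarrow> Id C b \<cdot> f = f"
    and id_right: "f \<in> Hom C a b \<Longrightarrow> f \<cdot> Id C a = f"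
    and assoc: "f \<in> Hom C a b \<Longrightarrow> g \<in> Hom C b c \<Longrightarrow> h \<in> Hom C c d \<Longrightarrow> (h \<cdot> g) \<cdot> f = h \<cdot> (g \<cdot> f)"

text \<open>
  Initial objects, colimits of chains and initial algebras are terminal objects, limits and final
  coalgebras in the opposite category, so the general facts about them come for free.
\<close>

definition opposite :: "('o, 'm) category \<Rightarrow> ('o, 'm) category" where
  "opposite C = \<lparr> Obj = Obj C, Hom = (\<lambda>a b. Hom C b a), Id = Id C, Comp = (\<lambda>g f. f \<cdot>\<^bsub>C\<^esub> g) \<rparr>"

lemma opposite_simps [simp]:
  "Obj (opposite C) = Obj C" "Hom (opposite C) a b = Hom C b a"
  "Id (opposite C) = Id C" "g \<cdot>\<^bsub>opposite C\<^esub> f = f \<cdot>\<^bsub>C\<^esub> g"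
  by (simp_all add: opposite_def)

lemma (in category_laws) opposite_category_laws: "category_laws (opposite C)"
  by unfold_locales (auto simp: hom_objs id_hom comp_hom id_left id_right assoc)

lemma is_limit_opposite: "is_limit (opposite C) X x I i = is_colimit C X x I i"
  by (simp add: is_limit_def is_colimit_def is_cone_def is_cocone_def)

lemma final_coalgebra_opposite: "final_coalgebra (opposite C) F A a = initial_algebra C F A a"
  by (simp add: final_coalgebra_def initial_algebra_def)

lemma is_functor_opposite: "is_functor C D F \<Longrightarrow> is_functor (opposite C) (opposite D) F"
  by (simp add: is_functor_def)

definition is_terminal :: "('o, 'm) category \<Rightarrow> 'o \<Rightarrow> bool" where
  "is_terminal C T \<longleftrightarrow> T \<in> Obj C \<and> (\<forall>a \<in> Obj C. \<exists>!h. h \<in> Hom C a T)"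

abbreviation is_initial :: "('o, 'm) category \<Rightarrow> 'o \<Rightarrow> bool" where
  "is_initial C \<equiv> is_terminal (opposite C)"

lemma terminal_arrow:
  assumes "is_terminal C T" "a \<in> Obj C"
  shows "the_arrow C a T \<in> Hom C a T"
  unfolding the_arrow_def using assms theI'[of "\<lambda>h. h \<in> Hom C a T"] by (simp add: is_terminal_def)

lemma initial_arrow:
  assumes "is_initial C T" "a \<in> Obj C"
  shows "the_arrow C T a \<in> Hom C T a"
  unfolding the_arrow_def using assms theI'[of "\<lambda>h. h \<in> Hom C T a"] by (simp add: is_terminal_def)

lemma terminal_unique:
  "is_terminal C T \<Longrightarrow> a \<in> Obj C \<Longrightarrow> f \<in> Hom C a T \<Longrightarrow> g \<in> Hom C a T \<Longrightarrow> f = g"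
  by (auto simp: is_terminal_def)

lemma initial_unique:
  "is_initial C T \<Longrightarrow> a \<in> Obj C \<Longrightarrow> f \<in> Hom C T a \<Longrightarrow> g \<in> Hom C T a \<Longrightarrow> f = g"
  by (auto simp: is_terminal_def)

lemma functor_ob: "is_functor C D F \<Longrightarrow> a \<in> Obj C \<Longrightarrow> ob F a \<in> Obj D"
  by (simp add: is_functor_def)

lemma functor_id: "is_functor C D F \<Longrightarrow> a \<in> Obj C \<Longrightarrow> ar F (Id C a) = Id D (ob F a)"
  by (simp add: is_functor_def)

lemma (in category_laws) functor_ar:
  "is_functor C D F \<Longrightarrow> f \<in> Hom C a b \<Longrightarrow> ar F f \<in> Hom D (ob F a) (ob F b)"
  using hom_objs by (fastforce simp: is_functor_def)

lemma (in category_laws) functor_comp: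
  "is_functor C D F \<Longrightarrow> f \<in> Hom C a b \<Longrightarrow> g \<in> Hom C b c \<Longrightarrow> ar F (g \<cdot> f) = ar F g \<cdot>\<^bsub>D\<^esub> ar F f"
  using hom_objs[of f a b] hom_objs[of g b c] unfolding is_functor_def by blast

lemma (in category_laws) functor_iso:
  assumes F: "is_functor C D F" and f: "is_iso C a b f"
  shows "is_iso D (ob F a) (ob F b) (ar F f)"
proof -
  obtain g where fg: "f \<in> Hom C a b" "g \<in> Hom C b a" "g \<cdot> f = Id C a" "f \<cdot> g = Id C b"
    using f by (auto simp: is_iso_def)
  then have "a \<in> Obj C" "b \<in> Obj C" using hom_objs by blast+
  with fg show ?thesis unfolding is_iso_def
    using functor_ar[OF F fg(1)] functor_ar[OF F fg(2)] functor_comp[OF F fg(1,2)]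
      functor_comp[OF F fg(2,1)] functor_id[OF F] by metis
qed

lemma (in category_laws) functor_power_iso:
  assumes F: "is_functor C C F" and f: "is_iso C a b f"
  shows "is_iso C ((ob F ^^ n) a) ((ob F ^^ n) b) ((ar F ^^ n) f)"
  by (induction n) (auto simp: f intro: functor_iso[OF F])

section \<open>The final coalgebra as the limit of the final sequence\<close>

lemma coneD:
  assumes "is_cone C X x Q q"
  shows "Q \<in> Obj C" "q n \<in> Hom C Q (X n)" "x n \<cdot>\<^bsub>C\<^esub> q (Suc n) = q n"
  using assms by (auto simp: is_cone_def)

lemma cone_factor:
  assumes "is_limit C X x L p" "is_cone C X x Q q"
  obtains h where "h \<in> Hom C Q L" "\<And>n. p n \<cdot>\<^bsub>C\<^esub> h = q n"
  using assms unfolding is_limit_def by blast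

lemma limit_cone: "is_limit C X x L p \<Longrightarrow> is_cone C X x L p"
  by (simp add: is_limit_def)

lemma (in category_laws) limit_jointly_monic:
  assumes L: "is_limit C X x L p" and x: "op_chain C X x"
    and f: "f \<in> Hom C Q L" and g: "g \<in> Hom C Q L" and eq: "\<And>n. p n \<cdot> f = p n \<cdot> g"
  shows "f = g"
proof -
  note cone = coneD[OF limit_cone[OF L]]
  have "x n \<cdot> (p (Suc n) \<cdot> f) = p n \<cdot> f" for n
    using assoc[OF f cone(2)[of "Suc n"], of "x n" "X n"] x cone(3)[of n] by (simp add: op_chain_def)
  then have "is_cone C X x Q (\<lambda>n. p n \<cdot> f)"
    using comp_hom[OF f cone(2)] hom_objs[OF f] by (simp add: is_cone_def)
  then show ?thesis using L f g eq unfolding is_limit_def by metis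
qed

lemma (in category_laws) colimit_jointly_epic:
  assumes "is_colimit C X x I i" "chain C X x" "f \<in> Hom C I Q" "g \<in> Hom C I Q"
    and "\<And>n. f \<cdot> i n = g \<cdot> i n"
  shows "f = g"
  using category_laws.limit_jointly_monic[OF opposite_category_laws, of X x I i f Q g] assms
  by (simp add: is_limit_opposite op_chain_def chain_def)

lemma (in category_laws) iterated_op_chain:
  assumes F: "is_functor C C F" and t: "t \<in> Hom C (ob F T) T"
  shows "op_chain C (\<lambda>n. (ob F ^^ n) T) (\<lambda>n. (ar F ^^ n) t)"
proof -
  have "(ar F ^^ n) t \<in> Hom C ((ob F ^^ Suc n) T) ((ob F ^^ n) T)" for n
    by (induction n) (use t functor_ar[OF F] in auto)
  then show ?thesis unfolding op_chain_def using hom_objs by blast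
qed

lemma (in category_laws) iterated_chain:
  assumes F: "is_functor C C F" and t: "t \<in> Hom C T (ob F T)"
  shows "chain C (\<lambda>n. (ob F ^^ n) T) (\<lambda>n. (ar F ^^ n) t)"
  using category_laws.iterated_op_chain[OF opposite_category_laws is_functor_opposite[OF F]] t
  by (simp add: op_chain_def chain_def)

text \<open>
  A cone over the tail of the chain extends in exactly one way to the whole chain, its missing
  component being forced by the first connecting arrow. The tail of the final sequence of \<open>F\<close> is
  the image of that sequence under \<open>F\<close>, so this compares \<open>L\<close> with \<open>F L\<close>.
\<close>

lemma (in category_laws) limit_tail:
  assumes x: "op_chain C X x" and L: "is_limit C X x L p"
  shows "is_limit C (\<lambda>n. X (Suc n)) (\<lambda>n. x (Suc n)) L (\<lambda>n. p (Suc n))"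
  unfolding is_limit_def
proof (intro conjI allI impI)
  note cone = coneD[OF limit_cone[OF L]]
  have xh: "x n \<in> Hom C (X (Suc n)) (X n)" for n using x by (simp add: op_chain_def)
  show "is_cone C (\<lambda>n. X (Suc n)) (\<lambda>n. x (Suc n)) L (\<lambda>n. p (Suc n))"
    using cone by (simp add: is_cone_def)
  fix Q q assume Q: "is_cone C (\<lambda>n. X (Suc n)) (\<lambda>n. x (Suc n)) Q q"
  note q = coneD[OF Q]
  have "is_cone C X x Q (case_nat (x 0 \<cdot> q 0) q)"
    unfolding is_cone_def using q comp_hom[OF q(2) xh] by (auto split: nat.split)
  then obtain h where h: "h \<in> Hom C Q L" "\<And>n. p n \<cdot> h = case_nat (x 0 \<cdot> q 0) q n"
    using cone_factor[OF L] by metis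
  show "\<exists>!h. h \<in> Hom C Q L \<and> (\<forall>n. p (Suc n) \<cdot> h = q n)"
  proof (rule ex1I[of _ h])
    show "h \<in> Hom C Q L \<and> (\<forall>n. p (Suc n) \<cdot> h = q n)" using h by simp
    fix k assume k: "k \<in> Hom C Q L \<and> (\<forall>n. p (Suc n) \<cdot> k = q n)"
    have "p 0 \<cdot> k = x 0 \<cdot> q 0"
      using assoc[OF _ cone(2) xh, of k Q 0] k cone(3)[of 0] by simp
    then have "p n \<cdot> k = p n \<cdot> h" for n using k h(2) by (cases n) auto
    then show "k = h" using limit_jointly_monic[OF L x] k h(1) by blast
  qed
qed

lemma (in category_laws) limit_unique_iso:
  assumes x: "op_chain C X x" and L: "is_limit C X x L p" and K: "is_limit C X x K k"
  obtains f where "is_iso C L K f" "\<And>n. k n \<cdot> f = p n"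
proof -
  note p = coneD[OF limit_cone[OF L]] and k = coneD[OF limit_cone[OF K]]
  obtain f where f: "f \<in> Hom C L K" "\<And>n. k n \<cdot> f = p n" using cone_factor[OF K limit_cone[OF L]] by blast
  obtain g where g: "g \<in> Hom C K L" "\<And>n. p n \<cdot> g = k n" using cone_factor[OF L limit_cone[OF K]] by blast
  have "g \<cdot> f = Id C L"
  proof (rule limit_jointly_monic[OF L x])
    show "p n \<cdot> (g \<cdot> f) = p n \<cdot> Id C L" for n
      using assoc[OF f(1) g(1) p(2)] f(2) g(2) id_right[OF p(2)] by simp
  qed (use comp_hom[OF f(1) g(1)] id_hom[OF p(1)] in auto)
  moreover have "f \<cdot> g = Id C K"
  proof (rule limit_jointly_monic[OF K x])
    show "k n \<cdot> (f \<cdot> g) = k n \<cdot> Id C K" for n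
      using assoc[OF g(1) f(1) k(2)] f(2) g(2) id_right[OF k(2)] by simp
  qed (use comp_hom[OF g(1) f(1)] id_hom[OF k(1)] in auto)
  ultimately show ?thesis using that[of f] f g unfolding is_iso_def by blast
qed

text \<open>
  Both \<open>L\<close> and \<open>F L\<close> are limits of the tail of the final sequence, whence \<open>\<xi>\<close>. A coalgebra \<open>(B, b)\<close>
  determines a cone by \<open>c 0 = !\<close> and \<open>c (n + 1) = F (c n) \<circ> b\<close>; since \<open>F (p n) \<circ> \<xi> = p (n + 1)\<close>,
  the coalgebra morphisms into \<open>(L, \<xi>)\<close> are precisely the factorizations of this cone.
\<close>

lemma (in category_laws) final_coalgebra_of_limit:
  fixes F :: "('o, 'm, 'o, 'm) functor_data" and T t
  defines "X \<equiv> \<lambda>n. (ob F ^^ n) T" and "x \<equiv> \<lambda>n. (ar F ^^ n) t"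
  assumes F: "is_functor C C F" and T: "is_terminal C T" and t: "t \<in> Hom C (ob F T) T"
    and L: "is_limit C X x L p"
    and FL: "is_limit C (\<lambda>n. ob F (X n)) (\<lambda>n. ar F (x n)) (ob F L) (\<lambda>n. ar F (p n))"
  shows "\<exists>\<xi>. is_iso C L (ob F L) \<xi> \<and> (\<forall>n. ar F (p n) \<cdot> \<xi> = p (Suc n)) \<and> final_coalgebra C F L \<xi>"
proof -
  have x: "op_chain C X x" unfolding X_def x_def by (rule iterated_op_chain[OF F t])
  have X0: "X 0 = T" and XS: "X (Suc n) = ob F (X n)" and xS: "x (Suc n) = ar F (x n)" for n
    by (simp_all add: X_def x_def)
  note p = coneD[OF limit_cone[OF L]]
  have xh: "x n \<in> Hom C (X (Suc n)) (X n)" for n using x by (simp add: op_chain_def)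
  have Fx: "op_chain C (\<lambda>n. ob F (X n)) (\<lambda>n. ar F (x n))"
    using x by (simp add: op_chain_def flip: XS xS)
  obtain \<xi> where iso: "is_iso C L (ob F L) \<xi>" and \<xi>p: "\<And>n. ar F (p n) \<cdot> \<xi> = p (Suc n)"
    using limit_unique_iso[OF Fx _ FL, of L "\<lambda>n. p (Suc n)"] limit_tail[OF x L] by (auto simp: XS xS)
  have \<xi>: "\<xi> \<in> Hom C L (ob F L)" using iso by (simp add: is_iso_def)
  have "\<exists>!h. h \<in> Hom C B L \<and> \<xi> \<cdot> h = ar F h \<cdot> b" if B: "B \<in> Obj C" and b: "b \<in> Hom C B (ob F B)" for B b
  proof -
    define c where "c = rec_nat (the_arrow C B T) (\<lambda>_ c. ar F c \<cdot> b)"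
    have c0: "c 0 = the_arrow C B T" and cS: "c (Suc n) = ar F (c n) \<cdot> b" for n
      by (simp_all add: c_def)
    have ch: "c n \<in> Hom C B (X n)" for n
    proof (induction n)
      case 0
      then show ?case using terminal_arrow[OF T B] by (simp add: c0 X0)
    next
      case (Suc n)
      then show ?case using comp_hom[OF b functor_ar[OF F Suc]] by (simp add: cS XS)
    qed
    have "x n \<cdot> c (Suc n) = c n" for n
    proof (induction n)
      case 0
      show ?case
        using terminal_unique[OF T B] comp_hom[OF ch xh, of 0] ch[of 0] by (simp add: X0)
    next
      case (Suc n)
      have "x (Suc n) \<cdot> c (Suc (Suc n)) = (ar F (x n) \<cdot> ar F (c (Suc n))) \<cdot> b"
        using assoc[OF b functor_ar[OF F ch] functor_ar[OF F xh]] by (simp add: cS xS)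
      also have "\<dots> = c (Suc n)"
        using functor_comp[OF F ch xh, of n] Suc cS[of n] by metis
      finally show ?case .
    qed
    then have "is_cone C X x B c" using B ch by (simp add: is_cone_def)
    then obtain h where h: "h \<in> Hom C B L" "\<And>n. p n \<cdot> h = c n" using cone_factor[OF L] by metis
    show ?thesis
    proof (rule ex1I[of _ h])
      have "\<xi> \<cdot> h = ar F h \<cdot> b"
      proof (rule limit_jointly_monic[OF FL Fx])
        fix n
        have "ar F (p n) \<cdot> (\<xi> \<cdot> h) = c (Suc n)"
          using assoc[OF h(1) \<xi> functor_ar[OF F p(2)]] \<xi>p h(2) by simp
        also have "\<dots> = ar F (p n) \<cdot> (ar F h \<cdot> b)"
          using assoc[OF b functor_ar[OF F h(1)] functor_ar[OF F p(2)]]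
            functor_comp[OF F h(1) p(2)] h(2) by (simp add: cS)
        finally show "ar F (p n) \<cdot> (\<xi> \<cdot> h) = ar F (p n) \<cdot> (ar F h \<cdot> b)" .
      qed (use comp_hom[OF h(1) \<xi>] comp_hom[OF b functor_ar[OF F h(1)]] in auto)
      then show "h \<in> Hom C B L \<and> \<xi> \<cdot> h = ar F h \<cdot> b" using h by simp
      fix k assume k: "k \<in> Hom C B L \<and> \<xi> \<cdot> k = ar F k \<cdot> b"
      then have kh: "k \<in> Hom C B L" by simp
      have "p n \<cdot> k = c n" for n
      proof (induction n)
        case 0
        show ?case
          using terminal_unique[OF T B] comp_hom[OF kh p(2), of 0] ch[of 0] by (simp add: X0)
      next
        case (Suc n)
        have "p (Suc n) \<cdot> k = ar F (p n) \<cdot> (ar F k \<cdot> b)"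
          using assoc[OF kh \<xi> functor_ar[OF F p(2)]] \<xi>p k by metis
        also have "\<dots> = c (Suc n)"
          using assoc[OF b functor_ar[OF F kh] functor_ar[OF F p(2)], of n]
            functor_comp[OF F kh p(2), of n] Suc by (simp add: cS)
        finally show ?case .
      qed
      then show "k = h" using limit_jointly_monic[OF L x kh h(1)] h(2) by simp
    qed
  qed
  then show ?thesis using iso \<xi>p \<xi> p(1) unfolding final_coalgebra_def by blast
qed

lemma (in category_laws) initial_algebra_of_colimit:
  fixes F :: "('o, 'm, 'o, 'm) functor_data" and T t
  defines "X \<equiv> \<lambda>n. (ob F ^^ n) T" and "x \<equiv> \<lambda>n. (ar F ^^ n) t"
  assumes F: "is_functor C C F" and T: "is_initial C T" and t: "t \<in> Hom C T (ob F T)"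
    and I: "is_colimit C X x I i"
    and FI: "is_colimit C (\<lambda>n. ob F (X n)) (\<lambda>n. ar F (x n)) (ob F I) (\<lambda>n. ar F (i n))"
  shows "\<exists>\<iota>. (\<forall>n. \<iota> \<cdot> ar F (i n) = i (Suc n)) \<and> initial_algebra C F I \<iota>"
  using category_laws.final_coalgebra_of_limit[OF opposite_category_laws is_functor_opposite[OF F] T, of t I i]
    t I FI by (auto simp: is_limit_opposite final_coalgebra_opposite X_def x_def)

section \<open>Algebras of a monad\<close>

locale monad_laws = category_laws C for C :: "('o, 'm) category" (structure) +
  fixes M :: "('o, 'm) monad_data"
  assumes monad: "is_monad C M"
begin

lemma M_functor: "is_functor C C M"
  using monad by (simp add: is_monad_def)

lemma mult_hom: "a \<in> Obj C \<Longrightarrow> mult M a \<in> Hom C (ob M (ob M a)) (ob M a)"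
  and unit_hom: "a \<in> Obj C \<Longrightarrow> unit M a \<in> Hom C a (ob M a)"
  and mult_assoc: "a \<in> Obj C \<Longrightarrow> mult M a \<cdot> ar M (mult M a) = mult M a \<cdot> mult M (ob M a)"
  and mult_unit: "a \<in> Obj C \<Longrightarrow> mult M a \<cdot> unit M (ob M a) = Id C (ob M a)"
  and mult_map_unit: "a \<in> Obj C \<Longrightarrow> mult M a \<cdot> ar M (unit M a) = Id C (ob M a)"
  using monad by (simp_all add: is_monad_def)

lemma mult_natural: "f \<in> Hom C a b \<Longrightarrow> mult M b \<cdot> ar M (ar M f) = ar M f \<cdot> mult M a"
  and unit_natural: "f \<in> Hom C a b \<Longrightarrow> unit M b \<cdot> f = ar M f \<cdot> unit M a"
  using monad hom_objs[of f a b] by (auto simp: is_monad_def)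

lemmas map_hom = functor_ar[OF M_functor] and map_comp = functor_comp[OF M_functor]

lemma Alg_obj_iff: "X \<in> Obj (Alg C M) \<longleftrightarrow> fst X \<in> Obj C \<and> snd X \<in> Hom C (ob M (fst X)) (fst X) \<and>
    snd X \<cdot> unit M (fst X) = Id C (fst X) \<and> snd X \<cdot> mult M (fst X) = snd X \<cdot> ar M (snd X)"
  by (simp add: Alg_def case_prod_beta)

lemma Alg_hom_iff: "h \<in> Hom (Alg C M) X Y \<longleftrightarrow> X \<in> Obj (Alg C M) \<and> Y \<in> Obj (Alg C M) \<and>
    src h = X \<and> trg h = Y \<and> und h \<in> Hom C (fst X) (fst Y) \<and> und h \<cdot> snd X = snd Y \<cdot> ar M (und h)"
  by (simp add: Alg_def)

lemma Alg_comp: "g \<cdot>\<^bsub>Alg C M\<^esub> f = Arrow (src f) (und g \<cdot> und f) (trg g)"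
  by (simp add: Alg_def)

lemma Alg_Id: "Id (Alg C M) X = Arrow X (Id C (fst X)) X"
  by (simp add: Alg_def)

lemma Alg_arrow_eqI: "h \<in> Hom (Alg C M) X Y \<Longrightarrow> k \<in> Hom (Alg C M) X Y \<Longrightarrow> und h = und k \<Longrightarrow> h = k"
  by (auto simp: Alg_hom_iff intro: arrow.expand)

lemma Alg_objD:
  assumes "X \<in> Obj (Alg C M)"
  shows "fst X \<in> Obj C" "snd X \<in> Hom C (ob M (fst X)) (fst X)"
    "snd X \<cdot> unit M (fst X) = Id C (fst X)" "snd X \<cdot> mult M (fst X) = snd X \<cdot> ar M (snd X)"
  using assms by (auto simp: Alg_obj_iff)

lemma Alg_homD:
  assumes "h \<in> Hom (Alg C M) X Y"
  shows "und h \<in> Hom C (fst X) (fst Y)" "und h \<cdot> snd X = snd Y \<cdot> ar M (und h)"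
    "X \<in> Obj (Alg C M)" "Y \<in> Obj (Alg C M)"
  using assms by (auto simp: Alg_hom_iff)

lemma Alg_comp_hom:
  assumes f: "f \<in> Hom (Alg C M) X Y" and g: "g \<in> Hom (Alg C M) Y Z"
  shows "g \<cdot>\<^bsub>Alg C M\<^esub> f \<in> Hom (Alg C M) X Z"
proof -
  note F = Alg_homD[OF f] and G = Alg_homD[OF g]
  note X = Alg_objD[OF F(3)] and Y = Alg_objD[OF F(4)] and Z = Alg_objD[OF G(4)]
  have "(und g \<cdot> und f) \<cdot> snd X = und g \<cdot> (snd Y \<cdot> ar M (und f))"
    using assoc[OF X(2) F(1) G(1)] F(2) by simp
  also have "\<dots> = snd Z \<cdot> (ar M (und g) \<cdot> ar M (und f))"
    using assoc[OF map_hom[OF F(1)] Y(2) G(1)] assoc[OF map_hom[OF F(1)] map_hom[OF G(1)] Z(2)] G(2)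
    by simp
  finally have "(und g \<cdot> und f) \<cdot> snd X = snd Z \<cdot> ar M (und g \<cdot> und f)"
    using map_comp[OF F(1) G(1)] by simp
  then show ?thesis using f g comp_hom[OF F(1) G(1)] by (simp add: Alg_hom_iff Alg_comp)
qed

lemma Alg_category_laws: "category_laws (Alg C M)"
proof
  show "Id (Alg C M) X \<in> Hom (Alg C M) X X" if "X \<in> Obj (Alg C M)" for X
    using that Alg_objD[OF that] functor_id[OF M_functor, of "fst X"] id_hom[of "fst X"]
      id_left[of "snd X"] id_right[of "snd X"]
    by (simp add: Alg_hom_iff Alg_Id)
  show "(h \<cdot>\<^bsub>Alg C M\<^esub> g) \<cdot>\<^bsub>Alg C M\<^esub> f = h \<cdot>\<^bsub>Alg C M\<^esub> (g \<cdot>\<^bsub>Alg C M\<^esub> f)"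
    if "f \<in> Hom (Alg C M) W X" "g \<in> Hom (Alg C M) X Y" "h \<in> Hom (Alg C M) Y Z" for f g h W X Y Z
    using assoc[OF Alg_homD(1)[OF that(1)] Alg_homD(1)[OF that(2)] Alg_homD(1)[OF that(3)]]
    by (simp add: Alg_comp)
  show "g \<cdot>\<^bsub>Alg C M\<^esub> f \<in> Hom (Alg C M) X Z" if "f \<in> Hom (Alg C M) X Y" "g \<in> Hom (Alg C M) Y Z" for f g X Y Z
    using that by (rule Alg_comp_hom)
qed (auto simp: Alg_hom_iff Alg_comp Alg_Id id_left id_right intro!: arrow.expand)

text \<open>
  All the equations that an algebra structure or an algebra morphism must satisfy hold
  because their two sides are arrows into \<open>T\<close>.
\<close>

lemma terminal_alg:
  assumes T: "is_terminal C T"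
  shows "is_terminal (Alg C M) (T, the_arrow C (ob M T) T)"
proof -
  have TO: "T \<in> Obj C" using T by (simp add: is_terminal_def)
  note MT = functor_ob[OF M_functor TO]
  let ?t = "the_arrow C (ob M T) T"
  have t: "?t \<in> Hom C (ob M T) T" by (rule terminal_arrow[OF T MT])
  have alg: "(T, ?t) \<in> Obj (Alg C M)"
    using terminal_unique[OF T TO comp_hom[OF unit_hom[OF TO] t] id_hom[OF TO]]
      terminal_unique[OF T functor_ob[OF M_functor MT]
        comp_hom[OF mult_hom[OF TO] t] comp_hom[OF map_hom[OF t] t]] t TO
    by (simp add: Alg_obj_iff)
  have "\<exists>!h. h \<in> Hom (Alg C M) X (T, ?t)" if X: "X \<in> Obj (Alg C M)" for X
  proof -
    note XD = Alg_objD[OF X]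
    let ?u = "the_arrow C (fst X) T"
    have u: "?u \<in> Hom C (fst X) T" by (rule terminal_arrow[OF T XD(1)])
    have "Arrow X ?u (T, ?t) \<in> Hom (Alg C M) X (T, ?t)"
      using X alg u terminal_unique[OF T functor_ob[OF M_functor XD(1)]
          comp_hom[OF XD(2) u] comp_hom[OF map_hom[OF u] t]]
      by (simp add: Alg_hom_iff)
    moreover have "h = k" if "h \<in> Hom (Alg C M) X (T, ?t)" "k \<in> Hom (Alg C M) X (T, ?t)" for h k
      using Alg_arrow_eqI[OF that] terminal_unique[OF T XD(1), of "und h" "und k"] that[THEN Alg_homD(1)] by simp
    ultimately show ?thesis by blast
  qed
  then show ?thesis using alg by (simp add: is_terminal_def)
qed

text \<open>
  The arrow into \<open>(A, a)\<close> is \<open>a \<circ> M !\<close>, the transpose of the unique arrow \<open>!\<close> from \<open>Z\<close> to \<open>A\<close>.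
\<close>

lemma initial_alg:
  assumes Z: "is_initial C Z"
  shows "is_initial (Alg C M) (free_alg M Z)"
proof -
  have ZO: "Z \<in> Obj C" using Z by (simp add: is_terminal_def)
  note MZ = functor_ob[OF M_functor ZO]
  have alg: "free_alg M Z \<in> Obj (Alg C M)"
    using mult_hom[OF ZO] mult_assoc[OF ZO] mult_unit[OF ZO] MZ by (simp add: free_alg_def Alg_obj_iff)
  have "\<exists>!h. h \<in> Hom (Alg C M) (free_alg M Z) X" if X: "X \<in> Obj (Alg C M)" for X
  proof -
    note XD = Alg_objD[OF X]
    let ?u = "the_arrow C Z (fst X)"
    have u: "?u \<in> Hom C Z (fst X)" by (rule initial_arrow[OF Z XD(1)])
    note Mu = map_hom[OF u] and MMu = map_hom[OF map_hom[OF u]]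
    have "(snd X \<cdot> ar M ?u) \<cdot> mult M Z = (snd X \<cdot> mult M (fst X)) \<cdot> ar M (ar M ?u)"
      using assoc[OF mult_hom[OF ZO] Mu XD(2)] assoc[OF MMu mult_hom[OF XD(1)] XD(2)]
        mult_natural[OF u] by simp
    also have "\<dots> = snd X \<cdot> ar M (snd X \<cdot> ar M ?u)"
      using assoc[OF MMu map_hom[OF XD(2)] XD(2)] map_comp[OF Mu XD(2)] XD(4) by simp
    finally have "Arrow (free_alg M Z) (snd X \<cdot> ar M ?u) X \<in> Hom (Alg C M) (free_alg M Z) X"
      using X alg comp_hom[OF Mu XD(2)] by (simp add: Alg_hom_iff free_alg_def)
    moreover have "h = k"
      if hk: "h \<in> Hom (Alg C M) (free_alg M Z) X" "k \<in> Hom (Alg C M) (free_alg M Z) X" for h k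
    proof -
      have und: "und h = snd X \<cdot> ar M ?u" if h: "h \<in> Hom (Alg C M) (free_alg M Z) X" for h
      proof -
        have h': "und h \<in> Hom C (ob M Z) (fst X)" "und h \<cdot> mult M Z = snd X \<cdot> ar M (und h)"
          using h by (simp_all add: Alg_hom_iff free_alg_def)
        note Mun = map_hom[OF unit_hom[OF ZO]]
        have "und h = und h \<cdot> (mult M Z \<cdot> ar M (unit M Z))"
          using mult_map_unit[OF ZO] id_right[OF h'(1)] by simp
        also have "\<dots> = (snd X \<cdot> ar M (und h)) \<cdot> ar M (unit M Z)"
          using assoc[OF Mun mult_hom[OF ZO] h'(1)] h'(2) by simp
        also have "\<dots> = snd X \<cdot> ar M (und h \<cdot> unit M Z)"
          using assoc[OF Mun map_hom[OF h'(1)] XD(2)] map_comp[OF unit_hom[OF ZO] h'(1)] by simp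
        also have "und h \<cdot> unit M Z = ?u"
          using initial_unique[OF Z XD(1) comp_hom[OF unit_hom[OF ZO] h'(1)] u] .
        finally show ?thesis .
      qed
      then show ?thesis using Alg_arrow_eqI[OF hk] und[OF hk(1)] und[OF hk(2)] by simp
    qed
    ultimately show ?thesis by blast
  qed
  then show ?thesis using alg by (simp add: is_terminal_def)
qed

text \<open>
  The structure map \<open>l\<close> has to satisfy \<open>p n \<circ> l = a n \<circ> M (p n)\<close>, where \<open>a n\<close> is the structure map of
  \<open>X n\<close>. The right-hand sides form a cone, so these equations define \<open>l\<close>, and every further
  equation can be checked after composition with the projections.
\<close>

lemma forgetful_creates_limits:
  assumes x: "op_chain (Alg C M) X x"
    and L: "is_limit C (\<lambda>n. fst (X n)) (\<lambda>n. und (x n)) L p"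
  shows "\<exists>!l. is_limit (Alg C M) X x (L, l) (\<lambda>n. Arrow (L, l) (p n) (X n))"
proof -
  note p = coneD[OF limit_cone[OF L]]
  have XO: "X n \<in> Obj (Alg C M)" and xA: "x n \<in> Hom (Alg C M) (X (Suc n)) (X n)" for n
    using x by (simp_all add: op_chain_def)
  note a = Alg_objD[OF XO] and xh = Alg_homD[OF xA]
  have ux: "op_chain C (\<lambda>n. fst (X n)) (\<lambda>n. und (x n))"
    using a(1) xh(1) by (simp add: op_chain_def)
  note monic = limit_jointly_monic[OF L ux]
  note Mp = map_hom[OF p(2)]
  have "und (x n) \<cdot> (snd (X (Suc n)) \<cdot> ar M (p (Suc n))) = snd (X n) \<cdot> ar M (p n)" for n
  proof -
    have "und (x n) \<cdot> (snd (X (Suc n)) \<cdot> ar M (p (Suc n)))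
        = (und (x n) \<cdot> snd (X (Suc n))) \<cdot> ar M (p (Suc n))"
      by (rule assoc[OF Mp a(2) xh(1), symmetric])
    also have "\<dots> = snd (X n) \<cdot> (ar M (und (x n)) \<cdot> ar M (p (Suc n)))"
      unfolding xh(2) by (rule assoc[OF Mp map_hom[OF xh(1)] a(2)])
    also have "\<dots> = snd (X n) \<cdot> ar M (p n)"
      by (simp only: map_comp[OF p(2) xh(1), symmetric] p(3))
    finally show ?thesis .
  qed
  then have "is_cone C (\<lambda>n. fst (X n)) (\<lambda>n. und (x n)) (ob M L) (\<lambda>n. snd (X n) \<cdot> ar M (p n))"
    using functor_ob[OF M_functor p(1)] comp_hom[OF Mp a(2)] by (simp add: is_cone_def)
  then obtain l where l: "l \<in> Hom C (ob M L) L" "\<And>n. p n \<cdot> l = snd (X n) \<cdot> ar M (p n)"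
    using cone_factor[OF L] by blast
  have "l \<cdot> unit M L = Id C L"
  proof (rule monic)
    fix n
    have "p n \<cdot> (l \<cdot> unit M L) = snd (X n) \<cdot> (unit M (fst (X n)) \<cdot> p n)"
      using assoc[OF unit_hom[OF p(1)] l(1) p(2)] assoc[OF unit_hom[OF p(1)] Mp a(2)] l(2)
        unit_natural[OF p(2)] by simp
    also have "\<dots> = p n"
      using assoc[OF p(2) unit_hom[OF a(1)] a(2)] a(3) id_left[OF p(2)] by simp
    finally show "p n \<cdot> (l \<cdot> unit M L) = p n \<cdot> Id C L" using id_right[OF p(2)] by simp
  qed (use comp_hom[OF unit_hom[OF p(1)] l(1)] id_hom[OF p(1)] in auto)
  moreover have "l \<cdot> mult M L = l \<cdot> ar M l"
  proof (rule monic)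
    fix n
    note MMp = map_hom[OF Mp[of n]]
    have "p n \<cdot> (l \<cdot> mult M L) = snd (X n) \<cdot> (mult M (fst (X n)) \<cdot> ar M (ar M (p n)))"
      using assoc[OF mult_hom[OF p(1)] l(1) p(2)] assoc[OF mult_hom[OF p(1)] Mp a(2)] l(2)
        mult_natural[OF p(2)] by simp
    also have "\<dots> = snd (X n) \<cdot> (ar M (snd (X n)) \<cdot> ar M (ar M (p n)))"
      using assoc[OF MMp mult_hom[OF a(1)] a(2)] assoc[OF MMp map_hom[OF a(2)] a(2)] a(4) by simp
    also have "\<dots> = snd (X n) \<cdot> (ar M (p n) \<cdot> ar M l)"
      using map_comp[OF Mp a(2), of n] map_comp[OF l(1) p(2), of n] l(2)[of n] by metis
    also have "\<dots> = p n \<cdot> (l \<cdot> ar M l)"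
      using assoc[OF map_hom[OF l(1)] Mp a(2)] assoc[OF map_hom[OF l(1)] l(1) p(2)] l(2) by simp
    finally show "p n \<cdot> (l \<cdot> mult M L) = p n \<cdot> (l \<cdot> ar M l)" .
  qed (use comp_hom[OF mult_hom[OF p(1)] l(1)] comp_hom[OF map_hom[OF l(1)] l(1)] in auto)
  ultimately have alg: "(L, l) \<in> Obj (Alg C M)" using p(1) l(1) by (simp add: Alg_obj_iff)
  let ?p = "\<lambda>n. Arrow (L, l) (p n) (X n)"
  have cone: "is_cone (Alg C M) X x (L, l) ?p"
    unfolding is_cone_def
  proof (intro conjI allI)
    show "?p n \<in> Hom (Alg C M) (L, l) (X n)" for n
      using alg XO[of n] p(2)[of n] l(2)[of n] by (simp add: Alg_hom_iff)
    show "x n \<cdot>\<^bsub>Alg C M\<^esub> ?p (Suc n) = ?p n" for n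
      using xA[of n] p(3)[of n] by (simp add: Alg_comp Alg_hom_iff)
  qed (rule alg)
  have "\<exists>!h. h \<in> Hom (Alg C M) Q (L, l) \<and> (\<forall>n. ?p n \<cdot>\<^bsub>Alg C M\<^esub> h = q n)"
    if Q: "is_cone (Alg C M) X x Q q" for Q q
  proof -
    note qA = coneD[OF Q]
    note q = Alg_homD[OF qA(2)]
    note b = Alg_objD[OF qA(1)]
    have "und (x n) \<cdot> und (q (Suc n)) = und (q n)" for n
      using arg_cong[OF qA(3)[of n], of und] by (simp add: Alg_comp)
    then have "is_cone C (\<lambda>n. fst (X n)) (\<lambda>n. und (x n)) (fst Q) (\<lambda>n. und (q n))"
      using b q(1) by (simp add: is_cone_def)
    then obtain h where h: "h \<in> Hom C (fst Q) L" "\<And>n. p n \<cdot> h = und (q n)"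
      using cone_factor[OF L] by blast
    have "h \<cdot> snd Q = l \<cdot> ar M h"
    proof (rule monic)
      fix n
      have "p n \<cdot> (h \<cdot> snd Q) = snd (X n) \<cdot> ar M (und (q n))"
        using assoc[OF b(2) h(1) p(2)] h(2) q(2) by simp
      also have "\<dots> = snd (X n) \<cdot> (ar M (p n) \<cdot> ar M h)"
        using map_comp[OF h(1) p(2)] h(2) by simp
      also have "\<dots> = p n \<cdot> (l \<cdot> ar M h)"
        using assoc[OF map_hom[OF h(1)] Mp a(2)] assoc[OF map_hom[OF h(1)] l(1) p(2)] l(2) by simp
      finally show "p n \<cdot> (h \<cdot> snd Q) = p n \<cdot> (l \<cdot> ar M h)" .
    qed (use comp_hom[OF b(2) h(1)] comp_hom[OF map_hom[OF h(1)] l(1)] in auto)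
    then have hA: "Arrow Q h (L, l) \<in> Hom (Alg C M) Q (L, l)"
      using h qA(1) alg by (simp add: Alg_hom_iff)
    show ?thesis
    proof (rule ex1I[of _ "Arrow Q h (L, l)"])
      show "Arrow Q h (L, l) \<in> Hom (Alg C M) Q (L, l) \<and>
          (\<forall>n. ?p n \<cdot>\<^bsub>Alg C M\<^esub> Arrow Q h (L, l) = q n)"
      proof (intro conjI allI)
        show "?p n \<cdot>\<^bsub>Alg C M\<^esub> Arrow Q h (L, l) = q n" for n
          using h(2)[of n] qA(2)[of n] by (cases "q n") (simp add: Alg_comp Alg_hom_iff)
      qed (rule hA)
      fix k assume k: "k \<in> Hom (Alg C M) Q (L, l) \<and> (\<forall>n. ?p n \<cdot>\<^bsub>Alg C M\<^esub> k = q n)"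
      have "p n \<cdot> und k = und (q n)" for n
        using arg_cong[OF spec[OF conjunct2[OF k], of n], of und] by (simp add: Alg_comp)
      moreover have "und k \<in> Hom C (fst Q) L" using k by (simp add: Alg_hom_iff)
      ultimately have "und k = h" using monic[OF _ h(1)] h(2) by metis
      then show "k = Arrow Q h (L, l)" using Alg_arrow_eqI[of k Q "(L, l)"] k hA by simp
    qed
  qed
  then have lim: "is_limit (Alg C M) X x (L, l) ?p" using cone by (simp add: is_limit_def)
  show ?thesis
  proof (rule ex1I[of _ l])
    show "is_limit (Alg C M) X x (L, l) ?p" by (rule lim)
    fix k assume "is_limit (Alg C M) X x (L, k) (\<lambda>n. Arrow (L, k) (p n) (X n))"
    then have c: "is_cone (Alg C M) X x (L, k) (\<lambda>n. Arrow (L, k) (p n) (X n))" by (rule limit_cone)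
    show "k = l"
    proof (rule monic)
      show "p n \<cdot> k = p n \<cdot> l" for n using Alg_homD(2)[OF coneD(2)[OF c, of n]] l(2) by simp
      show "k \<in> Hom C (ob M L) L" using Alg_objD(2)[OF coneD(1)[OF c]] by simp
    qed (rule l(1))
  qed
qed

lemma lifting_sequences:
  assumes Ht: "is_lifting C M H Ht"
  shows lifting_power_ob: "X \<in> Obj (Alg C M) \<Longrightarrow>
      (ob Ht ^^ n) X \<in> Obj (Alg C M) \<and> fst ((ob Ht ^^ n) X) = (ob H ^^ n) (fst X)"
    and lifting_power_ar: "h \<in> Hom (Alg C M) X Y \<Longrightarrow>
      (ar Ht ^^ n) h \<in> Hom (Alg C M) ((ob Ht ^^ n) X) ((ob Ht ^^ n) Y) \<and>
      und ((ar Ht ^^ n) h) = (ar H ^^ n) (und h)"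
proof -
  interpret A: category_laws "Alg C M" by (rule Alg_category_laws)
  have F: "is_functor (Alg C M) (Alg C M) Ht" using Ht by (simp add: is_lifting_def)
  show "(ob Ht ^^ n) X \<in> Obj (Alg C M) \<and> fst ((ob Ht ^^ n) X) = (ob H ^^ n) (fst X)"
    if "X \<in> Obj (Alg C M)"
    using that Ht by (induction n) (auto simp: is_lifting_def functor_ob[OF F])
  show "(ar Ht ^^ n) h \<in> Hom (Alg C M) ((ob Ht ^^ n) X) ((ob Ht ^^ n) Y) \<and>
      und ((ar Ht ^^ n) h) = (ar H ^^ n) (und h)" if "h \<in> Hom (Alg C M) X Y"
  proof (induction n)
    case 0
    then show ?case using that by simp
  next
    case (Suc n)
    then have h: "(ar Ht ^^ n) h \<in> Hom (Alg C M) ((ob Ht ^^ n) X) ((ob Ht ^^ n) Y)" by simp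
    have "und (ar Ht ((ar Ht ^^ n) h)) = ar H (und ((ar Ht ^^ n) h))"
      using Ht h A.hom_objs[OF h] unfolding is_lifting_def by blast
    then show ?case using Suc A.functor_ar[OF F h] by simp
  qed
qed

end

section \<open>The canonical morphism\<close>

text \<open>
  The matrix of components \<open>p m \<circ> f \<circ> i n\<close> is determined by its diagonal: composing with the
  connecting arrows lowers either index, and the entry \<open>(m, n)\<close> is reached from the diagonal
  entry \<open>(m + n, m + n)\<close>.
\<close>

lemma (in category_laws) chain_limit_arrow_eqI:
  assumes x: "op_chain C X x" and L: "is_limit C X x L p"
    and y: "chain C Y y" and I: "is_colimit C Y y I i"
    and f: "f \<in> Hom C I L" and g: "g \<in> Hom C I L"
    and diag: "\<And>n. p n \<cdot> (f \<cdot> i n) = p n \<cdot> (g \<cdot> i n)"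
  shows "f = g"
proof -
  note p = coneD[OF limit_cone[OF L]]
  have i: "i n \<in> Hom C (Y n) I" and iy: "i (Suc n) \<cdot> y n = i n" for n
    using I by (auto simp: is_colimit_def is_cocone_def)
  have xh: "x n \<in> Hom C (X (Suc n)) (X n)" and yh: "y n \<in> Hom C (Y n) (Y (Suc n))" for n
    using x y by (auto simp: op_chain_def chain_def)
  have down: "x m \<cdot> (p (Suc m) \<cdot> (k \<cdot> i n)) = p m \<cdot> (k \<cdot> i n)" if "k \<in> Hom C I L" for k m n
    using assoc[OF comp_hom[OF i that] p(2) xh, of m n] p(3)[of m] by simp
  have up: "(p m \<cdot> (k \<cdot> i (Suc n))) \<cdot> y n = p m \<cdot> (k \<cdot> i n)" if "k \<in> Hom C I L" for k m n
    using assoc[OF yh comp_hom[OF i that] p(2), of m n] assoc[OF yh i that, of n] iy[of n] by simp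
  have drop_rows: "p (m + j) \<cdot> (f \<cdot> i n) = p (m + j) \<cdot> (g \<cdot> i n) \<Longrightarrow> p m \<cdot> (f \<cdot> i n) = p m \<cdot> (g \<cdot> i n)"
    for m n j
  proof (induction j)
    case (Suc j)
    then show ?case using down[OF f, of "m + j" n] down[OF g, of "m + j" n] by simp
  qed simp
  have drop_columns: "p m \<cdot> (f \<cdot> i (n + j)) = p m \<cdot> (g \<cdot> i (n + j)) \<Longrightarrow> p m \<cdot> (f \<cdot> i n) = p m \<cdot> (g \<cdot> i n)"
    for m n j
  proof (induction j)
    case (Suc j)
    then show ?case using up[OF f, of m "n + j"] up[OF g, of m "n + j"] by simp
  qed simp
  have eq: "p m \<cdot> (f \<cdot> i n) = p m \<cdot> (g \<cdot> i n)" for m n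
    using drop_columns[OF drop_rows[of m n "n + m"]] diag[of "m + n"] by (simp add: add.commute)
  have "f \<cdot> i n = g \<cdot> i n" for n
    by (rule limit_jointly_monic[OF L x comp_hom[OF i f] comp_hom[OF i g] eq])
  then show ?thesis by (rule colimit_jointly_epic[OF I y f g])
qed

text \<open>
  The cone over the final sequence with vertex \<open>F L\<close> and components \<open>!\<close>, \<open>F (p 0)\<close>, \<open>F (p 1)\<close>, ...
  induces \<open>z : F L \<rightarrow> L\<close> with \<open>p (n + 1) \<circ> z = F (p n)\<close>. For the morphism \<open>f\<close> from the initial algebra
  to \<open>(L, z)\<close> one then gets
  \<open>p (n + 1) \<circ> f \<circ> i (n + 1) = p (n + 1) \<circ> z \<circ> F f \<circ> F (i n) = F (p n \<circ> f \<circ> i n)\<close>,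
  which is the induction step for the required equations.
\<close>

lemma (in category_laws) canonical_arrow_unique_exists:
  fixes F :: "('o, 'm, 'o, 'm) functor_data" and Z T s t j
  defines "X \<equiv> \<lambda>n. (ob F ^^ n) T" and "x \<equiv> \<lambda>n. (ar F ^^ n) t"
    and "Y \<equiv> \<lambda>n. (ob F ^^ n) Z" and "y \<equiv> \<lambda>n. (ar F ^^ n) j"
  assumes F: "is_functor C C F"
    and T: "is_terminal C T" and t: "t \<in> Hom C (ob F T) T" and L: "is_limit C X x L p"
    and j: "j \<in> Hom C Z (ob F Z)" and I: "is_colimit C Y y I i"
    and \<iota>: "initial_algebra C F I \<iota>" and \<iota>i: "\<And>n. \<iota> \<cdot> ar F (i n) = i (Suc n)"
    and s: "s \<in> Hom C Z T"
  shows "\<exists>!f. f \<in> Hom C I L \<and> (\<forall>n. p n \<cdot> (f \<cdot> i n) = (ar F ^^ n) s)"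
proof -
  have x: "op_chain C X x" unfolding X_def x_def by (rule iterated_op_chain[OF F t])
  have y: "chain C Y y" unfolding Y_def y_def by (rule iterated_chain[OF F j])
  have XS: "X 0 = T" "X (Suc n) = ob F (X n)" and xS: "x (Suc n) = ar F (x n)" and Y0: "Y 0 = Z" for n
    by (simp_all add: X_def x_def Y_def)
  note p = coneD[OF limit_cone[OF L]]
  have i: "i n \<in> Hom C (Y n) I" for n using I by (auto simp: is_colimit_def is_cocone_def)
  have xh: "x n \<in> Hom C (X (Suc n)) (X n)" for n using x by (simp add: op_chain_def)
  have \<iota>h: "\<iota> \<in> Hom C (ob F I) I" using \<iota> by (simp add: initial_algebra_def)
  note FL = functor_ob[OF F p(1)]
  define c where "c = case_nat (the_arrow C (ob F L) T) (\<lambda>n. ar F (p n))"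
  have c: "c 0 = the_arrow C (ob F L) T" "c (Suc n) = ar F (p n)" for n by (simp_all add: c_def)
  have ch: "c n \<in> Hom C (ob F L) (X n)" for n
    using terminal_arrow[OF T FL] functor_ar[OF F p(2)] by (cases n) (simp_all add: c XS)
  have xc: "x n \<cdot> c (Suc n) = c n" for n
  proof (cases n)
    case 0
    then show ?thesis
      using terminal_unique[OF T FL, of "x 0 \<cdot> c (Suc 0)" "c 0"] comp_hom[OF ch xh, of 0] ch[of 0]
      by (simp add: XS)
  next
    case (Suc m)
    then show ?thesis using functor_comp[OF F p(2) xh, of m] p(3)[of m] by (simp add: c xS)
  qed
  have "is_cone C X x (ob F L) c" using FL ch xc by (simp add: is_cone_def)
  then obtain z where z: "z \<in> Hom C (ob F L) L" "\<And>n. p n \<cdot> z = c n"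
    using cone_factor[OF L] by blast
  obtain f where f: "f \<in> Hom C I L" "f \<cdot> \<iota> = z \<cdot> ar F f"
    using \<iota> p(1) z(1) unfolding initial_algebra_def by blast
  have pfi: "p n \<cdot> (f \<cdot> i n) = (ar F ^^ n) s" for n
  proof (induction n)
    case 0
    have "p 0 \<cdot> (f \<cdot> i 0) \<in> Hom C Z T" using comp_hom[OF comp_hom[OF i f(1)] p(2), of 0 0] by (simp add: XS Y0)
    then show ?case using terminal_unique[OF T _ _ s] hom_objs[OF s] by simp
  next
    case (Suc n)
    note Fi = functor_ar[OF F i[of n]] and Ff = functor_ar[OF F f(1)] and Fp = functor_ar[OF F p(2)[of n]]
    have "f \<cdot> i (Suc n) = (f \<cdot> \<iota>) \<cdot> ar F (i n)"
      using assoc[OF Fi \<iota>h f(1)] \<iota>i[of n] by simp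
    also have "\<dots> = z \<cdot> (ar F f \<cdot> ar F (i n))"
      unfolding f(2) by (rule assoc[OF Fi Ff z(1)])
    finally have "p (Suc n) \<cdot> (f \<cdot> i (Suc n)) = p (Suc n) \<cdot> (z \<cdot> (ar F f \<cdot> ar F (i n)))" by simp
    also have "\<dots> = ar F (p n) \<cdot> (ar F f \<cdot> ar F (i n))"
      using assoc[OF comp_hom[OF Fi Ff] z(1) p(2), of "Suc n"] z(2)[of "Suc n"] c(2)[of n] by simp
    also have "\<dots> = ar F (p n \<cdot> (f \<cdot> i n))"
      using functor_comp[OF F i[of n] f(1)] functor_comp[OF F comp_hom[OF i[of n] f(1)] p(2)[of n]] by simp
    finally show ?case using Suc by simp
  qed
  show ?thesis
  proof (rule ex1I[of _ f])
    show "f \<in> Hom C I L \<and> (\<forall>n. p n \<cdot> (f \<cdot> i n) = (ar F ^^ n) s)" using f pfi by simp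
    fix g assume g: "g \<in> Hom C I L \<and> (\<forall>n. p n \<cdot> (g \<cdot> i n) = (ar F ^^ n) s)"
    then show "g = f" by (intro chain_limit_arrow_eqI[OF x L y I _ f(1)]) (simp_all add: pfi)
  qed
qed

section \<open>The category of sets\<close>

lemma Sets_obj [simp]: "Obj (Sets V) = V"
  by (simp add: Sets_def)

lemma Sets_hom_iff: "f \<in> Hom (Sets V) A B \<longleftrightarrow>
    A \<in> V \<and> B \<in> V \<and> src f = A \<and> trg f = B \<and> und f \<in> A \<rightarrow>\<^sub>E B"
  by (simp add: Sets_def)

lemma Sets_comp_apply:
  "f \<in> Hom (Sets V) A B \<Longrightarrow> a \<in> A \<Longrightarrow> und (g \<cdot>\<^bsub>Sets V\<^esub> f) a = und g (und f a)"
  by (simp add: Sets_def compose_def)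

lemma Sets_hom_apply: "f \<in> Hom (Sets V) A B \<Longrightarrow> a \<in> A \<Longrightarrow> und f a \<in> B"
  by (auto simp: Sets_hom_iff)

lemma Sets_arrow_eqI:
  assumes "f \<in> Hom (Sets V) A B" "g \<in> Hom (Sets V) A B" "\<And>a. a \<in> A \<Longrightarrow> und f a = und g a"
  shows "f = g"
proof (rule arrow.expand, intro conjI)
  have "und f \<in> A \<rightarrow>\<^sub>E B" "und g \<in> A \<rightarrow>\<^sub>E B" using assms(1,2) by (simp_all add: Sets_hom_iff)
  then show "und f = und g" by (rule PiE_ext) (rule assms(3))
qed (use assms(1,2) in \<open>simp_all add: Sets_hom_iff\<close>)

lemma Sets_category_laws: "category_laws (Sets V)"
proof
  show id: "Id (Sets V) A \<in> Hom (Sets V) A A" if "A \<in> Obj (Sets V)" for A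
    using that by (auto simp: Sets_def)
  show comp: "g \<cdot>\<^bsub>Sets V\<^esub> f \<in> Hom (Sets V) A D"
    if "f \<in> Hom (Sets V) A B" "g \<in> Hom (Sets V) B D" for f g A B D
    using that by (auto simp: Sets_def compose_def)
  show "A \<in> Obj (Sets V) \<and> B \<in> Obj (Sets V)" if "f \<in> Hom (Sets V) A B" for f A B
    using that by (simp add: Sets_hom_iff)
  have id_apply: "und (Id (Sets V) A) a = a" if "a \<in> A" for A a
    using that by (simp add: Sets_def)
  show "Id (Sets V) B \<cdot>\<^bsub>Sets V\<^esub> f = f" "f \<cdot>\<^bsub>Sets V\<^esub> Id (Sets V) A = f"
    if f: "f \<in> Hom (Sets V) A B" for f A B
  proof -
    have A: "Id (Sets V) A \<in> Hom (Sets V) A A" and B: "Id (Sets V) B \<in> Hom (Sets V) B B"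
      using f id by (simp_all add: Sets_hom_iff)
    show "Id (Sets V) B \<cdot>\<^bsub>Sets V\<^esub> f = f"
      by (rule Sets_arrow_eqI[OF comp[OF f B] f])
        (simp add: Sets_comp_apply[OF f] id_apply Sets_hom_apply[OF f])
    show "f \<cdot>\<^bsub>Sets V\<^esub> Id (Sets V) A = f"
      by (rule Sets_arrow_eqI[OF comp[OF A f] f]) (simp add: Sets_comp_apply[OF A] id_apply)
  qed
  show "(h \<cdot>\<^bsub>Sets V\<^esub> g) \<cdot>\<^bsub>Sets V\<^esub> f = h \<cdot>\<^bsub>Sets V\<^esub> (g \<cdot>\<^bsub>Sets V\<^esub> f)"
    if f: "f \<in> Hom (Sets V) A B" and g: "g \<in> Hom (Sets V) B D" and h: "h \<in> Hom (Sets V) D E" for f g h A B D E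
    by (rule Sets_arrow_eqI[OF comp[OF f comp[OF g h]] comp[OF comp[OF f g] h]])
      (simp add: Sets_comp_apply[OF f] Sets_comp_apply[OF g] Sets_comp_apply[OF comp[OF f g]]
        Sets_hom_apply[OF f])
qed

lemma Sets_singleton_terminal:
  assumes "{e} \<in> V"
  shows "is_terminal (Sets V) {e}"
  unfolding is_terminal_def
proof (intro conjI ballI)
  fix A assume A: "A \<in> Obj (Sets V)"
  have "Arrow A (\<lambda>a\<in>A. e) {e} \<in> Hom (Sets V) A {e}" using A assms by (simp add: Sets_hom_iff)
  moreover have "h = k" if "h \<in> Hom (Sets V) A {e}" "k \<in> Hom (Sets V) A {e}" for h k
    using Sets_arrow_eqI[OF that] that[THEN Sets_hom_apply] by simp
  ultimately show "\<exists>!h. h \<in> Hom (Sets V) A {e}" by blast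
qed (use assms in simp)

lemma Sets_empty_initial:
  assumes "{} \<in> V"
  shows "is_initial (Sets V) {}"
  unfolding is_terminal_def
proof (intro conjI ballI)
  fix A assume A: "A \<in> Obj (opposite (Sets V))"
  have "Arrow {} (\<lambda>a\<in>{}. undefined) A \<in> Hom (Sets V) {} A" using A assms by (simp add: Sets_hom_iff)
  moreover have "h = k" if "h \<in> Hom (Sets V) {} A" "k \<in> Hom (Sets V) {} A" for h k
    using Sets_arrow_eqI[OF that] by simp
  ultimately show "\<exists>!h. h \<in> Hom (opposite (Sets V)) A {}" by auto
qed (use assms in simp)

lemma set_universe_small:
  assumes "set_universe V"
  shows "{} \<in> V" "{e} \<in> V"
proof -
  obtain A where A: "A \<in> V" "infinite A" and sub: "\<And>B. B \<lesssim> A \<Longrightarrow> B \<in> V"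
    using assms unfolding set_universe_def by blast
  show "{} \<in> V" by (rule sub) (simp add: lepoll_def)
  obtain a where "a \<in> A" using A(2) by fastforce
  then show "{e} \<in> V" by (intro sub) (auto simp: lepoll_def intro!: exI[of _ "\<lambda>_. a"])
qed

lemma Sets_iso_surj:
  assumes f: "is_iso (Sets V) A B f" and b: "b \<in> B"
  obtains a where "a \<in> A" "und f a = b"
proof -
  obtain g where g: "g \<in> Hom (Sets V) B A" "f \<cdot>\<^bsub>Sets V\<^esub> g = Id (Sets V) B"
    using f by (auto simp: is_iso_def)
  have "und f (und g b) = b"
    using Sets_comp_apply[OF g(1) b, of f] unfolding g(2) using b by (simp add: Sets_def)
  then show ?thesis using that Sets_hom_apply[OF g(1) b] by blast
qed

text \<open>
  Points of a set are arrows from a singleton, so this is joint monicity of the projections at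
  points; the next lemma is likewise the factorization of a cone whose vertex is a singleton.
\<close>

lemma Sets_limit_separating:
  assumes x: "op_chain (Sets V) X x" and L: "is_limit (Sets V) X x L p" and e: "{e} \<in> V"
    and ab: "a \<in> L" "b \<in> L" and eq: "\<And>n. und (p n) a = und (p n) b"
  shows "a = b"
proof -
  interpret category_laws "Sets V" by (rule Sets_category_laws)
  note p = coneD[OF limit_cone[OF L]]
  define k where "k c = Arrow {e} (\<lambda>_\<in>{e}. c) L" for c :: 'a
  have k: "k c \<in> Hom (Sets V) {e} L" if "c \<in> L" for c
    using that e p(1) by (simp add: Sets_hom_iff k_def)
  have "k a = k b"
  proof (rule limit_jointly_monic[OF L x k[OF ab(1)] k[OF ab(2)]])
    fix n
    show "p n \<cdot>\<^bsub>Sets V\<^esub> k a = p n \<cdot>\<^bsub>Sets V\<^esub> k b"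
      by (rule Sets_arrow_eqI[OF comp_hom[OF k[OF ab(1)] p(2)] comp_hom[OF k[OF ab(2)] p(2)]])
        (simp add: Sets_comp_apply[OF k[OF ab(1)]] Sets_comp_apply[OF k[OF ab(2)]], simp add: k_def eq)
  qed
  then have "und (k a) e = und (k b) e" by simp
  then show ?thesis by (simp add: k_def)
qed

lemma Sets_limit_thread:
  assumes x: "op_chain (Sets V) X x" and L: "is_limit (Sets V) X x L p" and e: "{e} \<in> V"
    and z: "\<And>n. z n \<in> X n" and xz: "\<And>n. und (x n) (z (Suc n)) = z n"
  obtains a where "a \<in> L" "\<And>n. und (p n) a = z n"
proof -
  interpret category_laws "Sets V" by (rule Sets_category_laws)
  have xh: "X n \<in> V" "x n \<in> Hom (Sets V) (X (Suc n)) (X n)" for n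
    using x by (simp_all add: op_chain_def)
  define k where "k n = Arrow {e} (\<lambda>_\<in>{e}. z n) (X n)" for n
  have k: "k n \<in> Hom (Sets V) {e} (X n)" for n
    using z e xh(1) by (simp add: Sets_hom_iff k_def)
  have "x n \<cdot>\<^bsub>Sets V\<^esub> k (Suc n) = k n" for n
    by (rule Sets_arrow_eqI[OF comp_hom[OF k xh(2)] k])
      (simp add: Sets_comp_apply[OF k], simp add: k_def xz)
  then have "is_cone (Sets V) X x {e} k" using e k by (simp add: is_cone_def)
  then obtain h where h: "h \<in> Hom (Sets V) {e} L" "\<And>n. p n \<cdot>\<^bsub>Sets V\<^esub> h = k n"
    using cone_factor[OF L] by blast
  have "und (p n) (und h e) = z n" for n
    using Sets_comp_apply[OF h(1), of e "p n"] h(2)[of n] by (simp add: k_def)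
  then show ?thesis using that Sets_hom_apply[OF h(1)] by blast
qed

section \<open>The ultrametric of a separating sequence of quotients\<close>

text \<open>
  Only the kernels of the projections matter for the metric: they form a decreasing sequence of
  equivalence relations with trivial intersection.
\<close>

locale separating_sequence =
  fixes L :: "'u set" and p :: "nat \<Rightarrow> 'u set_arrow"
  assumes refining: "a \<in> L \<Longrightarrow> b \<in> L \<Longrightarrow> und (p (Suc n)) a = und (p (Suc n)) b \<Longrightarrow>
      und (p n) a = und (p n) b"
    and separating: "a \<in> L \<Longrightarrow> b \<in> L \<Longrightarrow> (\<And>n. und (p n) a = und (p n) b) \<Longrightarrow> a = b"
begin

lemma refining_le:
  assumes "a \<in> L" "b \<in> L" "und (p n) a = und (p n) b" "m \<le> n"
  shows "und (p m) a = und (p m) b"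
  using assms(4,3) by (induction rule: dec_induct) (auto intro: refining assms(1,2))

text \<open>
  The open balls of radius \<open>1 / 2 ^ n\<close> are the classes of the kernel of \<open>p n\<close>. All
  metric properties below are translated through this equivalence into statements about
  projections.
\<close>

lemma seq_dist_less_iff:
  assumes ab: "a \<in> L" "b \<in> L"
  shows "seq_dist p a b < 1 / 2 ^ n \<longleftrightarrow> und (p n) a = und (p n) b"
proof (cases "a = b")
  case False
  define k where "k = (LEAST n. und (p n) a \<noteq> und (p n) b)"
  have k: "und (p k) a \<noteq> und (p k) b"
    unfolding k_def using separating[OF ab] False by (metis (mono_tags, lifting) LeastI)
  have "seq_dist p a b < 1 / 2 ^ n \<longleftrightarrow> n < k"
    using False by (simp add: seq_dist_def k_def[symmetric] field_simps)
  also have "\<dots> \<longleftrightarrow> und (p n) a = und (p n) b"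
    using k refining_le[OF ab] not_less_Least[of n "\<lambda>n. und (p n) a \<noteq> und (p n) b"]
    by (metis k_def not_le)
  finally show ?thesis .
qed (simp add: seq_dist_def)

lemma seq_dist_pseudo_ultrametric: "pseudo_ultrametric L (seq_dist p)"
  unfolding pseudo_ultrametric_def
proof (intro conjI ballI)
  show "0 \<le> seq_dist p a b" for a b by (simp add: seq_dist_def)
  show "seq_dist p a a = 0" for a by (simp add: seq_dist_def)
  show "seq_dist p a b = seq_dist p b a" for a b by (simp add: seq_dist_def eq_commute)
  fix a b c assume abc: "a \<in> L" "b \<in> L" "c \<in> L"
  show "seq_dist p a c \<le> max (seq_dist p a b) (seq_dist p b c)"
  proof (cases "a = c")
    case True
    then show ?thesis by (simp add: seq_dist_def max_def)
  next
    case False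
    then obtain n where n: "seq_dist p a c = 1 / 2 ^ n" by (auto simp: seq_dist_def)
    then have "und (p n) a \<noteq> und (p n) c" using seq_dist_less_iff[of a c n] abc by simp
    then show ?thesis using seq_dist_less_iff[of a b n] seq_dist_less_iff[of b c n] abc n by fastforce
  qed
qed

sublocale Metric_space L "seq_dist p"
proof
  show "0 \<le> seq_dist p a b" for a b by (simp add: seq_dist_def)
  show "seq_dist p a b = seq_dist p b a" for a b by (simp add: seq_dist_def eq_commute)
  show "seq_dist p a b = 0 \<longleftrightarrow> a = b" for a b by (simp add: seq_dist_def)
  show "seq_dist p a c \<le> seq_dist p a b + seq_dist p b c" if "a \<in> L" "b \<in> L" "c \<in> L" for a b c
  proof -
    have "seq_dist p a c \<le> max (seq_dist p a b) (seq_dist p b c)"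
      using seq_dist_pseudo_ultrametric that by (simp add: pseudo_ultrametric_def)
    moreover have "0 \<le> seq_dist p a b" "0 \<le> seq_dist p b c" by (simp_all add: seq_dist_def)
    ultimately show ?thesis by linarith
  qed
qed

text \<open>
  If \<open>N n\<close> is an index from which on \<open>p n\<close> is constant along a Cauchy sequence \<open>\<sigma>\<close>, then the points
  \<open>\<sigma> (N n)\<close> form a thread, and any point realizing it is the limit of \<open>\<sigma>\<close>.
\<close>

lemma mcomplete_if_threads:
  assumes threads: "\<And>\<sigma>. range \<sigma> \<subseteq> L \<Longrightarrow> (\<And>n. und (p n) (\<sigma> (Suc n)) = und (p n) (\<sigma> n)) \<Longrightarrow>
      \<exists>a\<in>L. \<forall>n. und (p n) a = und (p n) (\<sigma> n)"
  shows mcomplete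
  unfolding mcomplete_def
proof (intro allI impI)
  fix \<sigma> assume \<sigma>: "MCauchy \<sigma>"
  then have \<sigma>L: "\<sigma> m \<in> L" for m by (auto simp: MCauchy_def)
  have "\<exists>N. \<forall>m\<ge>N. \<forall>m'\<ge>N. und (p n) (\<sigma> m) = und (p n) (\<sigma> m')" for n
  proof -
    have "\<exists>N. \<forall>m m'. N \<le> m \<longrightarrow> N \<le> m' \<longrightarrow> seq_dist p (\<sigma> m) (\<sigma> m') < 1 / 2 ^ n"
      using \<sigma> unfolding MCauchy_def by (meson zero_less_divide_1_iff zero_less_numeral zero_less_power)
    then show ?thesis using seq_dist_less_iff[OF \<sigma>L \<sigma>L] by blast
  qed
  then obtain N where N: "\<And>n m m'. m \<ge> N n \<Longrightarrow> m' \<ge> N n \<Longrightarrow> und (p n) (\<sigma> m) = und (p n) (\<sigma> m')"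
    by metis
  define \<tau> where "\<tau> n = \<sigma> (N n)" for n
  have "und (p n) (\<tau> (Suc n)) = und (p n) (\<tau> n)" for n
  proof -
    \<comment> \<open>\<open>N\<close> need not be monotone, so the two indices are compared through a common later one.\<close>
    let ?m = "max (N n) (N (Suc n))"
    have "und (p n) (\<sigma> (N (Suc n))) = und (p n) (\<sigma> ?m)"
      by (rule refining[OF \<sigma>L \<sigma>L]) (rule N; simp)
    also have "\<dots> = und (p n) (\<sigma> (N n))" by (rule N) simp_all
    finally show ?thesis by (simp add: \<tau>_def)
  qed
  then obtain a where a: "a \<in> L" "\<And>n. und (p n) a = und (p n) (\<tau> n)"
    using threads[of \<tau>] \<sigma>L by (auto simp: \<tau>_def)
  have "limitin mtopology \<sigma> a sequentially"
    unfolding limit_metric_sequentially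
  proof (intro conjI allI impI)
    fix \<epsilon> :: real assume "\<epsilon> > 0"
    then obtain n where n: "1 / 2 ^ n < \<epsilon>"
      using real_arch_pow_inv[of \<epsilon> "1/2"] by (auto simp: power_one_over)
    have "seq_dist p (\<sigma> m) a < \<epsilon>" if "m \<ge> N n" for m
      using seq_dist_less_iff[OF \<sigma>L a(1), of m n] a(2)[of n] N[of n m "N n"] that n by (simp add: \<tau>_def)
    then show "\<exists>N. \<forall>m\<ge>N. \<sigma> m \<in> L \<and> seq_dist p (\<sigma> m) a < \<epsilon>" using \<sigma>L by blast
  qed (rule a(1))
  then show "\<exists>a. limitin mtopology \<sigma> a sequentially" by blast
qed

lemma dense_if_projections_agree:
  assumes S: "S \<subseteq> L" and agree: "\<And>a n. a \<in> L \<Longrightarrow> \<exists>b\<in>S. und (p n) b = und (p n) a"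
  shows "mtopology closure_of S = L"
proof -
  have "\<exists>b\<in>S. b \<in> mball a r" if a: "a \<in> L" and "r > 0" for a r
  proof -
    obtain n where n: "1 / 2 ^ n < r"
      using real_arch_pow_inv[of r "1/2"] \<open>r > 0\<close> by (auto simp: power_one_over)
    obtain b where b: "b \<in> S" "und (p n) b = und (p n) a" using agree[OF a] by blast
    then have "seq_dist p a b < r" using seq_dist_less_iff[of a b n] a S n by auto
    then show ?thesis using a b S by (auto simp: in_mball)
  qed
  then show ?thesis by (auto simp: metric_closure_of)
qed

end

lemma completion_of_dense_map:
  assumes "Metric_space Y d" "Metric_space.mcomplete Y d" "g ` X \<subseteq> Y"
    and "Metric_space.mtopology Y d closure_of (g ` X) = Y"
  shows "is_cauchy_completion X (\<lambda>a b. d (g a) (g b)) Y d g"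
  using assms by (simp add: is_cauchy_completion_def)

lemma pseudo_ultrametric_pullback:
  "pseudo_ultrametric Y d \<Longrightarrow> g ` X \<subseteq> Y \<Longrightarrow> pseudo_ultrametric X (\<lambda>a b. d (g a) (g b))"
  unfolding pseudo_ultrametric_def by (simp add: image_subset_iff)

section \<open>The completion theorem\<close>


theorem theorem7:
  fixes V :: "'u set set" and e :: 'u
    and H :: "'u set_endofunctor" and M :: "'u set_monad" and Ht :: "'u alg_endofunctor"
    and L :: "'u set" and p :: "nat \<Rightarrow> 'u set_arrow"
    and I :: "'u alg" and i :: "nat \<Rightarrow> 'u alg_arrow"
  assumes "set_universe V"
    and "is_functor (Sets V) (Sets V) H"
    and "omega_op_continuous (Sets V) (Sets V) H"
    and "is_monad (Sets V) M"
    and "is_lifting (Sets V) M H Ht"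
    and "omega_cocontinuous (Alg (Sets V) M) (Alg (Sets V) M) Ht"
    and "is_iso (Alg (Sets V) M) (free_alg M {}) (one_alg V M e) (init_to_one V M e)"
    and "is_limit (Sets V) (final_seq_ob H e) (final_seq_ar V H e) L p"
    and "is_colimit (Alg (Sets V) M) (init_seq_ob M Ht) (init_seq_ar V M Ht) I i"
  shows "(\<exists>\<xi>. is_iso (Sets V) L (ob H L) \<xi> \<and>
              (\<forall>n. ar H (p n) \<cdot>\<^bsub>Sets V\<^esub> \<xi> = p (Suc n)) \<and>
              final_coalgebra (Sets V) H L \<xi>) \<and>
         (\<exists>\<iota>. (\<forall>n. \<iota> \<cdot>\<^bsub>Alg (Sets V) M\<^esub> ar Ht (i n) = i (Suc n)) \<and>
              initial_algebra (Alg (Sets V) M) Ht I \<iota>) \<and>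
         (\<exists>!f. canonical_morphism V H M Ht e L p I i f) \<and>
         (\<forall>f. canonical_morphism V H M Ht e L p I i f \<longrightarrow>
            pseudo_ultrametric L (seq_dist p) \<and>
            Metric_space L (seq_dist p) \<and>
            Metric_space.mcomplete L (seq_dist p) \<and>
            Metric_space.mtopology L (seq_dist p) closure_of (und (und f) ` fst I) = L \<and>
            is_cauchy_completion (und (und f) ` fst I) (seq_dist p) L (seq_dist p) (\<lambda>x. x) \<and>
            pseudo_ultrametric (fst I) (\<lambda>a b. seq_dist p (und (und f) a) (und (und f) b)) \<and>
            is_cauchy_completion (fst I) (\<lambda>a b. seq_dist p (und (und f) a) (und (und f) b))
              L (seq_dist p) (und (und f)))"
proof -
  let ?C = "Sets V" and ?A = "Alg (Sets V) M"
  note H = assms(2)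
  have one: "{e} \<in> V" and zero: "{} \<in> V" using set_universe_small[OF assms(1)] by blast+
  interpret S: category_laws ?C by (rule Sets_category_laws)
  interpret M: monad_laws ?C M by unfold_locales (rule assms(4))
  interpret A: category_laws ?A by (rule M.Alg_category_laws)
  note lift_ob = M.lifting_power_ob[OF assms(5)] and lift_ar = M.lifting_power_ar[OF assms(5)]
  have Ht: "is_functor ?A ?A Ht" using assms(5) by (simp add: is_lifting_def)
  have T: "is_terminal ?C {e}" by (rule Sets_singleton_terminal[OF one])
  have TA: "is_terminal ?A (one_alg V M e)" unfolding one_alg_def by (rule M.terminal_alg[OF T])
  have ZA: "is_initial ?A (free_alg M {})" by (rule M.initial_alg[OF Sets_empty_initial[OF zero]])
  have one_obj: "one_alg V M e \<in> Obj ?A" and free_obj: "free_alg M {} \<in> Obj ?A"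
    using TA ZA by (simp_all add: is_terminal_def)
  note fst_one = arg_cong[OF one_alg_def, of fst, unfolded fst_conv]

  let ?t = "the_arrow ?C (ob H {e}) {e}"
  let ?tA = "the_arrow ?A (ob Ht (one_alg V M e)) (one_alg V M e)"
  let ?j = "the_arrow ?A (free_alg M {}) (ob Ht (free_alg M {}))"
  have t: "?t \<in> Hom ?C (ob H {e}) {e}" by (rule terminal_arrow[OF T functor_ob[OF H]]) (simp add: one)
  have tA: "?tA \<in> Hom ?A (ob Ht (one_alg V M e)) (one_alg V M e)"
    by (rule terminal_arrow[OF TA functor_ob[OF Ht one_obj]])
  have j: "?j \<in> Hom ?A (free_alg M {}) (ob Ht (free_alg M {}))"
    by (rule initial_arrow[OF ZA functor_ob[OF Ht free_obj]])
  have s: "init_to_one V M e \<in> Hom ?A (free_alg M {}) (one_alg V M e)"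
    using assms(7) by (simp add: is_iso_def)
  \<comment> \<open>The two final sequences have the same underlying chain of sets because the unique algebra
     morphism to the terminal algebra lies over the unique map to the singleton.\<close>
  have und_tA: "und ?tA = ?t"
  proof (rule terminal_unique[OF T _ _ t])
    show "und ?tA \<in> Hom ?C (ob H {e}) {e}"
      using M.Alg_homD(1)[OF tA] lift_ob[OF one_obj, of 1] by (simp add: fst_one)
  qed (use functor_ob[OF H] one in simp)

  have x: "op_chain ?C (final_seq_ob H e) (final_seq_ar V H e)"
    using S.iterated_op_chain[OF H t] by (simp add: final_seq_ob_def[abs_def] final_seq_ar_def[abs_def])
  have xA: "op_chain ?A (alg_final_seq_ob V M Ht e) (alg_final_seq_ar V M Ht e)"
    using A.iterated_op_chain[OF Ht tA]
    by (simp add: alg_final_seq_ob_def[abs_def] alg_final_seq_ar_def[abs_def])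
  have fst_seq: "(\<lambda>n. fst (alg_final_seq_ob V M Ht e n)) = final_seq_ob H e"
    using lift_ob[OF one_obj] by (simp add: fun_eq_iff alg_final_seq_ob_def final_seq_ob_def fst_one)
  have und_seq: "(\<lambda>n. und (alg_final_seq_ar V M Ht e n)) = final_seq_ar V H e"
    using lift_ar[OF tA] und_tA by (simp add: fun_eq_iff alg_final_seq_ar_def final_seq_ar_def)

  let ?L = "limit_alg V M Ht e L p"
  let ?p = "\<lambda>n. Arrow ?L (p n) (alg_final_seq_ob V M Ht e n)"
  have LA: "is_limit ?A (alg_final_seq_ob V M Ht e) (alg_final_seq_ar V M Ht e) ?L ?p"
    unfolding limit_alg_def
    using theI'[OF M.forgetful_creates_limits[OF xA, of L p, unfolded fst_seq und_seq, OF assms(8)]] .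

  have final: "\<exists>\<xi>. is_iso ?C L (ob H L) \<xi> \<and> (\<forall>n. ar H (p n) \<cdot>\<^bsub>?C\<^esub> \<xi> = p (Suc n)) \<and>
      final_coalgebra ?C H L \<xi>"
  proof (rule S.final_coalgebra_of_limit[OF H T t])
    note eqs = final_seq_ob_def[abs_def] final_seq_ar_def[abs_def]
    show "is_limit ?C (\<lambda>n. (ob H ^^ n) {e}) (\<lambda>n. (ar H ^^ n) ?t) L p" using assms(8) by (simp only: eqs)
    show "is_limit ?C (\<lambda>n. ob H ((ob H ^^ n) {e})) (\<lambda>n. ar H ((ar H ^^ n) ?t)) (ob H L) (\<lambda>n. ar H (p n))"
      using assms(3)[unfolded omega_op_continuous_def, rule_format, OF conjI[OF x assms(8)]]
      by (simp only: eqs)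
  qed

  have IA: "is_colimit ?A (\<lambda>n. (ob Ht ^^ n) (free_alg M {})) (\<lambda>n. (ar Ht ^^ n) ?j) I i"
    using assms(9) by (simp only: init_seq_ob_def[abs_def] init_seq_ar_def[abs_def])
  have initial: "\<exists>\<iota>. (\<forall>n. \<iota> \<cdot>\<^bsub>?A\<^esub> ar Ht (i n) = i (Suc n)) \<and> initial_algebra ?A Ht I \<iota>"
  proof (rule A.initial_algebra_of_colimit[OF Ht ZA j IA])
    show "is_colimit ?A (\<lambda>n. ob Ht ((ob Ht ^^ n) (free_alg M {}))) (\<lambda>n. ar Ht ((ar Ht ^^ n) ?j))
        (ob Ht I) (\<lambda>n. ar Ht (i n))"
      by (rule assms(6)[unfolded omega_cocontinuous_def, rule_format,
            OF conjI[OF A.iterated_chain[OF Ht j] IA]])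
  qed

  have i: "i n \<in> Hom ?A ((ob Ht ^^ n) (free_alg M {})) I" for n
    using IA by (simp add: is_colimit_def is_cocone_def)
  \<comment> \<open>The canonical morphism is specified by equations between maps of sets. They are equivalent to
     equations between algebra morphisms, since such a morphism is determined by its underlying map.\<close>
  have canonical_iff: "canonical_morphism V H M Ht e L p I i f \<longleftrightarrow>
      f \<in> Hom ?A I ?L \<and> (\<forall>n. ?p n \<cdot>\<^bsub>?A\<^esub> (f \<cdot>\<^bsub>?A\<^esub> i n) = (ar Ht ^^ n) (init_to_one V M e))" for f
  proof -
    have "p n \<cdot>\<^bsub>?C\<^esub> und f \<cdot>\<^bsub>?C\<^esub> und (i n) = (ar H ^^ n) (und (init_to_one V M e)) \<longleftrightarrow>
        ?p n \<cdot>\<^bsub>?A\<^esub> (f \<cdot>\<^bsub>?A\<^esub> i n) = (ar Ht ^^ n) (init_to_one V M e)" if f: "f \<in> Hom ?A I ?L" for n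
    proof -
      have "?p n \<cdot>\<^bsub>?A\<^esub> (f \<cdot>\<^bsub>?A\<^esub> i n) \<in> Hom ?A ((ob Ht ^^ n) (free_alg M {})) ((ob Ht ^^ n) (one_alg V M e))"
        using A.comp_hom[OF A.comp_hom[OF i f] coneD(2)[OF limit_cone[OF LA]], of n n]
        by (simp add: alg_final_seq_ob_def)
      note eqI = M.Alg_arrow_eqI[OF this conjunct1[OF lift_ar[OF s, of n]]]
      have "?p n \<cdot>\<^bsub>?A\<^esub> (f \<cdot>\<^bsub>?A\<^esub> i n) = (ar Ht ^^ n) (init_to_one V M e) \<longleftrightarrow>
          und (?p n \<cdot>\<^bsub>?A\<^esub> (f \<cdot>\<^bsub>?A\<^esub> i n)) = und ((ar Ht ^^ n) (init_to_one V M e))"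
        by (rule iffI) (erule arg_cong, erule eqI)
      then show ?thesis using lift_ar[OF s, of n] by (simp add: M.Alg_comp)
    qed
    then show ?thesis unfolding canonical_morphism_def by blast
  qed
  have canonical: "\<exists>!f. canonical_morphism V H M Ht e L p I i f"
  proof -
    obtain \<iota> where \<iota>: "initial_algebra ?A Ht I \<iota>" "\<And>n. \<iota> \<cdot>\<^bsub>?A\<^esub> ar Ht (i n) = i (Suc n)"
      using initial by blast
    show ?thesis unfolding canonical_iff
      by (rule A.canonical_arrow_unique_exists[OF Ht TA tA _ j IA \<iota> s])
        (use LA in \<open>simp add: alg_final_seq_ob_def[abs_def] alg_final_seq_ar_def[abs_def]\<close>)
  qed

  note p = coneD[OF limit_cone[OF assms(8)]]
  have p_Suc: "und (p n) a = und (final_seq_ar V H e n) (und (p (Suc n)) a)" if "a \<in> L" for n a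
    using Sets_comp_apply[OF p(2) that, of "final_seq_ar V H e n" "Suc n"] p(3)[of n] by simp
  interpret D: separating_sequence L p
  proof
    show "und (p n) a = und (p n) b"
      if "a \<in> L" "b \<in> L" "und (p (Suc n)) a = und (p (Suc n)) b" for a b n
      unfolding p_Suc[OF that(1), of n] p_Suc[OF that(2), of n] that(3) ..
  qed (rule Sets_limit_separating[OF x assms(8) one])
  \<comment> \<open>A sequence that \<open>p n\<close> stabilizes from index \<open>n\<close> on gives the compatible points
     \<open>p n (\<sigma> n)\<close> of the final sequence, which the limit realizes.\<close>
  have complete: "D.mcomplete"
  proof (rule D.mcomplete_if_threads)
    fix \<sigma> :: "nat \<Rightarrow> 'u"
    assume \<sigma>: "range \<sigma> \<subseteq> L" "\<And>n. und (p n) (\<sigma> (Suc n)) = und (p n) (\<sigma> n)"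
    have "und (p n) (\<sigma> n) \<in> final_seq_ob H e n" for n
      using Sets_hom_apply[OF p(2)] \<sigma>(1) by blast
    moreover have "und (final_seq_ar V H e n) (und (p (Suc n)) (\<sigma> (Suc n))) = und (p n) (\<sigma> n)" for n
      using p_Suc[of "\<sigma> (Suc n)" n] \<sigma>(1) \<sigma>(2)[of n] by (metis range_subsetD)
    ultimately show "\<exists>a\<in>L. \<forall>n. und (p n) a = und (p n) (\<sigma> n)"
      using Sets_limit_thread[OF x assms(8) one, of "\<lambda>n. und (p n) (\<sigma> n)"] by metis
  qed

  have s_iso: "is_iso ?C (ob M {}) {e} (und (init_to_one V M e))"
  proof -
    obtain r where r: "r \<in> Hom ?A (one_alg V M e) (free_alg M {})"
      "r \<cdot>\<^bsub>?A\<^esub> init_to_one V M e = Id ?A (free_alg M {})"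
      "init_to_one V M e \<cdot>\<^bsub>?A\<^esub> r = Id ?A (one_alg V M e)"
      using assms(7) by (auto simp: is_iso_def)
    show ?thesis unfolding is_iso_def
      using M.Alg_homD(1)[OF s] M.Alg_homD(1)[OF r(1)] arg_cong[OF r(2), of und] arg_cong[OF r(3), of und]
      by (auto simp: M.Alg_comp M.Alg_Id fst_one free_alg_def intro!: bexI[of _ "und r"])
  qed
  have dense: "und (und f) ` fst I \<subseteq> L \<and> D.mtopology closure_of (und (und f) ` fst I) = L"
    if f: "canonical_morphism V H M Ht e L p I i f" for f
  proof -
    have fh: "und f \<in> Hom ?C (fst I) L"
      using f M.Alg_homD(1)[of f I ?L] by (simp add: canonical_morphism_def limit_alg_def)
    have ih: "und (i n) \<in> Hom ?C ((ob H ^^ n) (ob M {})) (fst I)" for n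
      using M.Alg_homD(1)[OF i[of n]] lift_ob[OF free_obj, of n] by (simp add: free_alg_def)
    have sub: "und (und f) ` fst I \<subseteq> L" using Sets_hom_apply[OF fh] by blast
    have "\<exists>b\<in>und (und f) ` fst I. und (p n) b = und (p n) a" if a: "a \<in> L" for a n
    proof -
      have "und (p n) a \<in> (ob H ^^ n) {e}"
        using Sets_hom_apply[OF p(2) a, of n] by (simp add: final_seq_ob_def)
      then obtain c where c: "c \<in> (ob H ^^ n) (ob M {})"
        "und ((ar H ^^ n) (und (init_to_one V M e))) c = und (p n) a"
        using Sets_iso_surj[OF S.functor_power_iso[OF H s_iso, of n]] by blast
      have "und (p n) (und (und f) (und (und (i n)) c)) = und (p n \<cdot>\<^bsub>?C\<^esub> und f \<cdot>\<^bsub>?C\<^esub> und (i n)) c"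
        using Sets_comp_apply[OF S.comp_hom[OF ih fh] c(1)] Sets_comp_apply[OF ih c(1)] by simp
      also have "\<dots> = und (p n) a" using f c(2) by (simp add: canonical_morphism_def)
      finally show ?thesis using Sets_hom_apply[OF ih c(1)] by blast
    qed
    then show ?thesis using D.dense_if_projections_agree[OF sub] sub by blast
  qed
  have metric: "pseudo_ultrametric L (seq_dist p) \<and> Metric_space L (seq_dist p) \<and>
      Metric_space.mcomplete L (seq_dist p) \<and>
      Metric_space.mtopology L (seq_dist p) closure_of (und (und f) ` fst I) = L \<and>
      is_cauchy_completion (und (und f) ` fst I) (seq_dist p) L (seq_dist p) (\<lambda>x. x) \<and>
      pseudo_ultrametric (fst I) (\<lambda>a b. seq_dist p (und (und f) a) (und (und f) b)) \<and>
      is_cauchy_completion (fst I) (\<lambda>a b. seq_dist p (und (und f) a) (und (und f) b))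
        L (seq_dist p) (und (und f))"
    if "canonical_morphism V H M Ht e L p I i f" for f
    using dense[OF that] complete D.Metric_space_axioms D.seq_dist_pseudo_ultrametric
      completion_of_dense_map[OF D.Metric_space_axioms complete, of "und (und f)" "fst I"]
      completion_of_dense_map[OF D.Metric_space_axioms complete, of "\<lambda>x. x" "und (und f) ` fst I"]
      pseudo_ultrametric_pullback[OF D.seq_dist_pseudo_ultrametric, of "und (und f)" "fst I"]
    by simp
  show ?thesis using final initial canonical metric by blast
qed

end
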